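(* Let $L$ be a fixed symplectic form on $\mathbb{R}^{2g}$ and let $M\in \mathrm{Sp}(2g,\mathbb{Z},L)$ be such that $M$ has a unique, real eigenvalue of largest modulus greater than $1$. Suppose also that this eigenvalue has algebraic multiplicity $1$. Then there exist $n\in\mathbb{N}$ and $B\in \mathrm{GL}(2g,\mathbb{R})$ such that $B^{-1}M^nB$ is a Perron-Frobenius matrix in $\mathrm{Sp}(2g,\mathbb{Z},L)$.
   Context: A symplectic form on $\mathbb{R}^{2g}$ is a non-degenerate skew-symmetric bilinear form; its matrix in the standard basis is also denoted $L$. $\mathrm{Sp}(2g,\mathbb{Z},L)$ denotes the group of $2g\times 2g$ integer matrices $N$ which preserve $L$, i.e. $N^T L N = L$. A real square matrix is Perron-Frobenius if all its entries are nonnegative and some power of it (with exponent $k\in\mathbb{N}$) has strictly positive entries.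
   Formalization: The formal theorem also assumes that some nonzero real multiple of L has rational entries; for arbitrary real L the claim fails, e.g. L = J ⊕ √2 J, M = [[2,1],[1,1]] ⊕ I_2, where every element of Sp(4,Z,L) is block diagonal. *)

theory Defs
  imports "Jordan_Normal_Form.Char_Poly" Complex_Main
begin

(* The form (x, y) |-> x^T L y on R^m, given by its matrix L in the standard basis. *)
definition symplectic_form :: "nat \<Rightarrow> real mat \<Rightarrow> bool" where
  "symplectic_form m L \<longleftrightarrow>
     L \<in> carrier_mat m m \<and>
     (\<forall>x \<in> carrier_vec m. \<forall>y \<in> carrier_vec m. x \<bullet> (L *\<^sub>v y) = - (y \<bullet> (L *\<^sub>v x))) \<and>
     (\<forall>x \<in> carrier_vec m. (\<forall>y \<in> carrier_vec m. x \<bullet> (L *\<^sub>v y) = 0) \<longrightarrow> x = 0\<^sub>v m)"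

(* L may have arbitrary real entries here. If no nonzero multiple of L is rational, this group
   can be too small to contain a Perron-Frobenius matrix: for J (+) sqrt 2 * J, with J the
   standard 2x2 form, all its elements are block diagonal. *)
definition Sp_int :: "nat \<Rightarrow> real mat \<Rightarrow> real mat set" where
  "Sp_int m L =
     {N \<in> carrier_mat m m. elements_mat N \<subseteq> \<int> \<and> transpose_mat N * L * N = L}"

definition Perron_Frobenius_mat :: "real mat \<Rightarrow> bool" where
  "Perron_Frobenius_mat A \<longleftrightarrow>
     square_mat A \<and> (\<forall>a \<in> elements_mat A. a \<ge> 0) \<and>
     (\<exists>k \<ge> 1. \<forall>a \<in> elements_mat (A ^\<^sub>m k). a > 0)"

(* The modulus condition quantifies over all complex eigenvalues, and the algebraic
   multiplicity is the order of the root in the characteristic polynomial. *)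
definition simple_dominant_eigenvalue :: "real mat \<Rightarrow> real \<Rightarrow> bool" where
  "simple_dominant_eigenvalue M r \<longleftrightarrow>
     (let M' = map_mat complex_of_real M in
        eigenvalue M' (complex_of_real r) \<and>
        (\<forall>z. eigenvalue M' z \<and> z \<noteq> complex_of_real r \<longrightarrow> cmod z < \<bar>r\<bar>) \<and>
        Polynomial.order (complex_of_real r) (char_poly M') = 1)"

end

theory Submission
  imports Defs "Jordan_Normal_Form.Spectral_Radius"
begin

text \<open>
  Normalised by the dominant eigenvalue \<open>r\<close>, the powers of \<open>M\<close> converge to a rank one projection
  \<open>v w\<^sup>T\<close>. Hence, if \<open>A\<close> is invertible with inverse \<open>B\<close> and both \<open>A v\<close> and \<open>B\<^sup>T w\<close> are strictly
  positive, then \<open>A M\<^sup>n B\<close> is strictly positive for all large even \<open>n\<close>. Writing \<open>w = L u\<close>, this asks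
  for a symplectic \<open>A\<close> with \<open>A v\<close> and \<open>L A u\<close> positive, and a product of two symplectic
  transvections achieves this. Positivity is an open condition and transvections depend continuously
  on their parameters, so \<open>A\<close> can be taken rational, as a multiple of \<open>L\<close> is rational. Finally \<open>M\<close>
  is unimodular, so some power of it is congruent to the identity modulo the square of a common
  denominator \<open>q\<close> of \<open>A\<close> and \<open>B\<close>, which makes \<open>A M\<^sup>n B\<close> integral.
\<close>

section \<open>Powers of a matrix with a simple dominant eigenvalue\<close>

text \<open>Matrices of all sizes share one type, so convergence is taken entrywise over the index
  range of the limit \<open>Y\<close>. The dimensions of \<open>X k\<close> are left open here;
  lemmas that need them ask for them separately.\<close>

definition mat_lim :: "(nat \<Rightarrow> 'a::real_normed_algebra_1 mat) \<Rightarrow> 'a mat \<Rightarrow> bool" where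
  "mat_lim X Y \<longleftrightarrow>
     (\<forall>i < dim_row Y. \<forall>j < dim_col Y. (\<lambda>k. X k $$ (i, j)) \<longlonglongrightarrow> Y $$ (i, j))"

lemma mat_lim_const: "mat_lim (\<lambda>_. X) X"
  by (simp add: mat_lim_def)

lemma mat_lim_mult:
  assumes "\<And>k. X k \<in> carrier_mat nr n" "\<And>k. Y k \<in> carrier_mat n nc"
    and "X' \<in> carrier_mat nr n" "Y' \<in> carrier_mat n nc"
    and "mat_lim X X'" "mat_lim Y Y'"
  shows "mat_lim (\<lambda>k. X k * Y k) (X' * Y')"
  unfolding mat_lim_def
proof (intro allI impI)
  fix i j assume "i < dim_row (X' * Y')" "j < dim_col (X' * Y')"
  then have ij: "i < nr" "j < nc" using assms by auto
  have "(\<lambda>k. \<Sum>l = 0..<n. X k $$ (i, l) * Y k $$ (l, j)) \<longlonglongrightarrow> (\<Sum>l = 0..<n. X' $$ (i, l) * Y' $$ (l, j))"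
    using assms(3-6) ij unfolding mat_lim_def by (intro tendsto_sum tendsto_mult) auto
  moreover have "(X k * Y k) $$ (i, j) = (\<Sum>l = 0..<n. X k $$ (i, l) * Y k $$ (l, j))" for k
    using assms(1,2)[of k] ij by (simp add: scalar_prod_def)
  moreover have "(X' * Y') $$ (i, j) = (\<Sum>l = 0..<n. X' $$ (i, l) * Y' $$ (l, j))"
    using assms(3,4) ij by (simp add: scalar_prod_def)
  ultimately show "(\<lambda>k. (X k * Y k) $$ (i, j)) \<longlonglongrightarrow> (X' * Y') $$ (i, j)"
    by simp
qed

section \<open>Scaling and decay of matrix powers\<close>

lemma eigenvalue_smult:
  fixes A :: "'a::field mat"
  assumes A: "A \<in> carrier_mat n n" and c: "c \<noteq> 0" and e: "eigenvalue (c \<cdot>\<^sub>m A) z"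
  shows "eigenvalue A (z / c)"
proof -
  from e obtain v where v: "v \<in> carrier_vec n" "v \<noteq> 0\<^sub>v n" "(c \<cdot>\<^sub>m A) *\<^sub>v v = z \<cdot>\<^sub>v v"
    using A unfolding eigenvalue_def eigenvector_def by auto
  have "A *\<^sub>v v = (z / c) \<cdot>\<^sub>v v"
  proof (rule eq_vecI)
    fix i assume "i < dim_vec ((z / c) \<cdot>\<^sub>v v)"
    then have i: "i < n" using v by auto
    have "((c \<cdot>\<^sub>m A) *\<^sub>v v) $ i = (z \<cdot>\<^sub>v v) $ i" using v by simp
    moreover have "((c \<cdot>\<^sub>m A) *\<^sub>v v) $ i = c * (A *\<^sub>v v) $ i"
      using i v(1) A by (simp add: scalar_prod_def sum_distrib_left mult.assoc)
    ultimately have "c * (A *\<^sub>v v) $ i = z * v $ i"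
      using i v(1) by simp
    then show "(A *\<^sub>v v) $ i = ((z / c) \<cdot>\<^sub>v v) $ i"
      using i v c by (simp add: field_simps)
  qed (use A v in auto)
  then show ?thesis using v A unfolding eigenvalue_def eigenvector_def by auto
qed

lemma pow_mat_smult:
  fixes A :: "'a::comm_ring_1 mat"
  assumes A: "A \<in> carrier_mat n n"
  shows "(c \<cdot>\<^sub>m A) ^\<^sub>m k = c ^ k \<cdot>\<^sub>m (A ^\<^sub>m k)"
proof (induction k)
  case (Suc k)
  have Ak: "A ^\<^sub>m k \<in> carrier_mat n n" using A by simp
  have "(c \<cdot>\<^sub>m A) ^\<^sub>m Suc k = c ^ k \<cdot>\<^sub>m (A ^\<^sub>m k) * (c \<cdot>\<^sub>m A)" by (simp add: Suc)
  also have "\<dots> = c \<cdot>\<^sub>m (c ^ k \<cdot>\<^sub>m (A ^\<^sub>m k * A))"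
    using A Ak by (simp add: mult_smult_distrib[of _ n n _ n] mult_smult_assoc_mat[of _ n n _ n])
  also have "\<dots> = c ^ Suc k \<cdot>\<^sub>m (A ^\<^sub>m Suc k)"
    using A Ak by (intro eq_matI) (auto simp: ac_simps)
  finally show ?case .
qed (use A in auto)

lemma one_pow_mat: "1\<^sub>m n ^\<^sub>m k = (1\<^sub>m n :: 'a::semiring_1 mat)"
  by (induction k) auto

text \<open>Boundedness of the powers below spectral radius one is upgraded to decay by rescaling:
  for \<open>t\<close> strictly between the spectral radius and 1, the matrix \<open>A / t\<close>
  still has spectral radius below 1, so its powers are bounded and the entries of
  \<open>A ^ k\<close> are O(\<open>t ^ k\<close>).\<close>

lemma mat_lim_pow_0:
  fixes A :: "complex mat"
  assumes A: "A \<in> carrier_mat n n" and ev: "\<And>z. eigenvalue A z \<Longrightarrow> cmod z < 1"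
  shows "mat_lim (\<lambda>k. A ^\<^sub>m k) (0\<^sub>m n n)"
proof (cases "n = 0")
  case False
  then have n: "n > 0" by simp
  define s where "s = spectral_radius A"
  from spectral_radius_mem_max(1)[OF A n] obtain z0 where "eigenvalue A z0" "cmod z0 = s"
    unfolding spectrum_def s_def by auto
  then have s: "0 \<le> s" "s < 1" using ev by auto
  define t where "t = (s + 1) / 2"
  have t: "0 < t" "t < 1" "s < t" using s unfolding t_def by auto
  define B where "B = complex_of_real (1 / t) \<cdot>\<^sub>m A"
  have B: "B \<in> carrier_mat n n" using A unfolding B_def by simp
  from spectral_radius_mem_max(1)[OF B n] obtain z where z: "eigenvalue B z" "cmod z = spectral_radius B"
    unfolding spectrum_def by auto
  have "eigenvalue A (z / complex_of_real (1 / t))"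
    by (rule eigenvalue_smult[OF A]) (use z t in \<open>auto simp: B_def\<close>)
  then have "cmod (z / complex_of_real (1 / t)) \<in> norm ` spectrum A"
    unfolding spectrum_def by blast
  from spectral_radius_mem_max(2)[OF A n this] have "cmod z * t \<le> s"
    using t by (simp add: norm_divide s_def norm_mult)
  with t have "cmod z * t < 1 * t" by linarith
  then have "cmod z < 1" using t(1) by (simp add: mult_less_cancel_right)
  then have "spectral_radius B < 1" using z by simp
  from spectral_radius_jnf_norm_bound_less_1_upper_triangular[OF B this] obtain c
    where c: "\<And>k. norm_bound (B ^\<^sub>m k) c" by auto
  have A_B: "A = complex_of_real t \<cdot>\<^sub>m B" unfolding B_def using t
    by (intro eq_matI) auto
  have pow: "A ^\<^sub>m k = complex_of_real t ^ k \<cdot>\<^sub>m (B ^\<^sub>m k)" for k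
    unfolding A_B by (rule pow_mat_smult[OF B])
  show ?thesis unfolding mat_lim_def
  proof (intro allI impI)
    fix i j assume "i < dim_row (0\<^sub>m n n :: complex mat)" "j < dim_col (0\<^sub>m n n :: complex mat)"
    then have ij: "i < n" "j < n" by auto
    have "norm ((A ^\<^sub>m k) $$ (i, j)) \<le> c * t ^ k" for k
    proof -
      have Bk: "B ^\<^sub>m k \<in> carrier_mat n n" using B by simp
      have "(A ^\<^sub>m k) $$ (i, j) = complex_of_real t ^ k * (B ^\<^sub>m k) $$ (i, j)"
        using carrier_matD[OF Bk] ij by (simp add: pow)
      moreover have "norm ((B ^\<^sub>m k) $$ (i, j)) \<le> c"
        using c[of k] ij unfolding norm_bound_def carrier_matD[OF Bk] by blast
      ultimately show ?thesis using t
        by (simp add: norm_mult norm_power mult.commute mult_right_mono)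
    qed
    \<comment> \<open>The norm on the right replaces a sign condition on \<open>c\<close>, and the
      factor 1 is the constant of the comparison test below.\<close>
    then have "norm ((A ^\<^sub>m k) $$ (i, j)) \<le> norm (c * t ^ k) * 1" for k
      using abs_ge_self[of "c * t ^ k"] order_trans unfolding real_norm_def mult_1_right by blast
    then have "\<forall>\<^sub>F k in sequentially. norm ((A ^\<^sub>m k) $$ (i, j)) \<le> norm (c * t ^ k) * 1"
      by (intro always_eventually allI)
    moreover have "(\<lambda>k. c * t ^ k) \<longlonglongrightarrow> 0"
      using t by (intro tendsto_mult_right_zero LIMSEQ_power_zero) auto
    ultimately have "(\<lambda>k. (A ^\<^sub>m k) $$ (i, j)) \<longlonglongrightarrow> 0"
      by (rule tendsto_0_le[rotated])
    then show "(\<lambda>k. (A ^\<^sub>m k) $$ (i, j)) \<longlonglongrightarrow> 0\<^sub>m n n $$ (i, j)"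
      using ij by simp
  qed
qed (simp add: mat_lim_def)

section \<open>Splitting off a simple eigenvalue\<close>

lemma det_nonzero_inverse:
  fixes A :: "'a::field mat"
  assumes A: "A \<in> carrier_mat n n" and d: "det A \<noteq> 0"
  obtains B where "B \<in> carrier_mat n n" "A * B = 1\<^sub>m n" "B * A = 1\<^sub>m n"
  using det_non_zero_imp_unit[OF A d, of "()"] that
  unfolding Units_def ring_mat_def by auto

text \<open>A Schur form with \<open>r\<close> in the top left corner is block triangular.
  Simplicity keeps \<open>r\<close> out of the spectrum of the remaining block \<open>D\<close>, so
  \<open>r I - D\<close> is invertible and a unipotent conjugation removes the rest of the first
  row.\<close>

lemma simple_eigenvalue_block_diag:
  fixes A :: "complex mat"
  assumes A: "A \<in> carrier_mat n n" and ord: "Polynomial.order r (char_poly A) = 1"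
  obtains m P Q D where "P \<in> carrier_mat n n" "Q \<in> carrier_mat n n" "D \<in> carrier_mat m m"
    "P * Q = 1\<^sub>m n" "Q * P = 1\<^sub>m n" "n = Suc m"
    "A = P * four_block_mat (r \<cdot>\<^sub>m 1\<^sub>m 1) (0\<^sub>m 1 m) (0\<^sub>m m 1) D * Q"
    "\<And>z. eigenvalue D z \<Longrightarrow> eigenvalue A z \<and> z \<noteq> r"
proof -
  obtain as where as: "char_poly A = (\<Prod>a\<leftarrow>as. [:- a, 1:])" "length as = n"
    using char_poly_factorized[OF A] by auto
  have cp0: "char_poly A \<noteq> 0" using degree_monic_char_poly[OF A] by auto
  have root: "poly (char_poly A) r = 0" using ord order_root by (metis zero_neq_one)
  then have "r \<in> set as" unfolding as by (auto simp: poly_prod_list prod_list_zero_iff)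
  \<comment> \<open>The Schur decomposition lists the eigenvalues along the diagonal in the order
    prescribed, so putting \<open>r\<close> first places it in the corner.\<close>
  define es where "es = r # remove1 r as"
  from \<open>r \<in> set as\<close> have "mset es = mset as" by (simp add: es_def)
  then have es: "char_poly A = (\<Prod>a\<leftarrow>es. [:- a, 1:])"
    unfolding as by (metis mset_map prod_mset_prod_list)
  obtain m where n: "n = Suc m" using \<open>r \<in> set as\<close> as(2) by (cases as) auto
  obtain U S T where "schur_decomposition A es = (U, S, T)" by (metis prod_cases3)
  from schur_decomposition[OF A es this]
  have sim: "similar_mat_wit A U S T" and ut: "upper_triangular U" and dg: "diag_mat U = es" by auto
  note w = similar_mat_witD2[OF A sim]
  obtain U1 U2 U0 D where sp: "split_block U 1 1 = (U1, U2, U0, D)" by (metis prod_cases4)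
  have dims: "dim_row U = 1 + m" "dim_col U = 1 + m" using w n by auto
  note blk = split_block[OF sp dims]
  have U0: "U0 = 0\<^sub>m m 1"
    using sp ut dims unfolding split_block_def Let_def
    by (intro eq_matI) (auto simp: upper_triangular_def)
  have "U $$ (0, 0) = r"
    using arg_cong[OF dg, of "\<lambda>xs. xs ! 0"] dims unfolding diag_mat_def es_def by (simp del: upt_Suc)
  then have U1: "U1 = r \<cdot>\<^sub>m 1\<^sub>m 1"
    using sp dims unfolding split_block_def Let_def by (intro eq_matI) auto
  have cp: "char_poly A = char_poly U1 * char_poly D"
    using char_poly_similar[of A U] sim char_poly_four_block_zeros_col[OF blk(1,2,4)] blk(5) U0
    unfolding similar_mat_def by metis
  have cpU1: "char_poly U1 = [:- r, 1:]"
    unfolding U1 by (simp add: char_poly_defs det_def sign_def)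
  have D: "D \<in> carrier_mat m m" by (rule blk(4))
  have evD: "eigenvalue A z \<and> z \<noteq> r" if "eigenvalue D z" for z
  proof
    have z: "poly (char_poly D) z = 0" using that eigenvalue_root_char_poly[OF D] by simp
    then show "eigenvalue A z" unfolding eigenvalue_root_char_poly[OF A] cp by simp
    show "z \<noteq> r"
    proof
      assume "z = r"
      \<comment> \<open>The block \<open>U1\<close> already contributes one factor X - r; a second
        one from \<open>D\<close> would raise the multiplicity to at least 2.\<close>
      then have "[:- r, 1:] dvd char_poly D" using z poly_eq_0_iff_dvd by blast
      then have "[:- r, 1:] ^ 2 dvd char_poly A"
        unfolding cp cpU1 power2_eq_square by (rule mult_dvd_mono[OF dvd_refl])
      then have "2 \<le> Polynomial.order r (char_poly A)" using cp0 order_max by blast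
      then show False using ord by simp
    qed
  qed
  \<comment> \<open>Clear the off-diagonal block \<open>U2\<close>: the row \<open>y\<close> solving \<open>y (r I - D) = U2\<close> gives the conjugating matrix \<open>V\<close>.\<close>
  define R where "R = r \<cdot>\<^sub>m 1\<^sub>m m - D"
  have R: "R \<in> carrier_mat m m" unfolding R_def by (rule minus_carrier_mat[OF D])
  have "det R \<noteq> 0"
  proof
    assume "det R = 0"
    then obtain x where x: "x \<in> carrier_vec m" "x \<noteq> 0\<^sub>v m" "R *\<^sub>v x = 0\<^sub>v m"
      using det_0_iff_vec_prod_zero[OF R] by auto
    have "D *\<^sub>v x = r \<cdot>\<^sub>v x"
    proof (rule eq_vecI)
      fix i assume "i < dim_vec (r \<cdot>\<^sub>v x)"
      then have i: "i < m" using x by simp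
      have "R *\<^sub>v x = (r \<cdot>\<^sub>m 1\<^sub>m m) *\<^sub>v x - D *\<^sub>v x"
        unfolding R_def using D x(1) by (intro minus_mult_distrib_mat_vec) auto
      also have "(r \<cdot>\<^sub>m 1\<^sub>m m) *\<^sub>v x = r \<cdot>\<^sub>v x"
        using x(1) by (intro eq_vecI) auto
      finally have "(r \<cdot>\<^sub>v x - D *\<^sub>v x) $ i = 0\<^sub>v m $ i" by (simp only: x(3))
      then show "(D *\<^sub>v x) $ i = (r \<cdot>\<^sub>v x) $ i" using D x(1) i by simp
    qed (use D x in auto)
    then have "eigenvalue D r" using x D unfolding eigenvalue_def eigenvector_def by auto
    then show False using evD by blast
  qed
  then obtain C where C: "C \<in> carrier_mat m m" "C * R = 1\<^sub>m m"
    using det_nonzero_inverse[OF R] by metis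
  define y where "y = U2 * C"
  have y: "y \<in> carrier_mat 1 m" unfolding y_def using blk(2) C by simp
  have yR: "y * R = U2" unfolding y_def
    using assoc_mult_mat[OF blk(2) C(1) R] C(2) blk(2) by simp
  \<comment> \<open>This is the top right block of the identity \<open>V * U = E * V\<close> proved
    below, and the only block in which \<open>U2\<close> and \<open>y\<close> enter
    nontrivially.\<close>
  have "U2 + y * D = r \<cdot>\<^sub>m y"
  proof (rule eq_matI)
    fix i j assume "i < dim_row (r \<cdot>\<^sub>m y)" "j < dim_col (r \<cdot>\<^sub>m y)"
    then have ij: "i < 1" "j < m" using y by auto
    have "y * R = y * (r \<cdot>\<^sub>m 1\<^sub>m m) - y * D"
      unfolding R_def using y D by (intro mult_minus_distrib_mat) auto
    also have "y * (r \<cdot>\<^sub>m 1\<^sub>m m) = r \<cdot>\<^sub>m y"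
      using mult_smult_distrib[OF y one_carrier_mat] y by simp
    finally have "U2 $$ (i, j) = (r \<cdot>\<^sub>m y - y * D) $$ (i, j)" by (simp only: yR)
    then show "(U2 + y * D) $$ (i, j) = (r \<cdot>\<^sub>m y) $$ (i, j)"
      using ij carrier_matD[OF y] carrier_matD[OF D] carrier_matD[OF blk(2)]
      by (simp del: index_mult_mat(1))
  qed (use y blk(2) D in auto)
  note yU = this
  define Z I where "Z = (0\<^sub>m m 1 :: complex mat)" and "I = (1\<^sub>m m :: complex mat)"
  have ZI: "Z \<in> carrier_mat m 1" "I \<in> carrier_mat m m" unfolding Z_def I_def by auto
  define E where "E = four_block_mat (r \<cdot>\<^sub>m 1\<^sub>m 1) (0\<^sub>m 1 m) Z D"
  define V where "V = four_block_mat (1\<^sub>m 1) y Z I"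
  define V' where "V' = four_block_mat (1\<^sub>m 1) (- y) Z I"
  have one: "four_block_mat (1\<^sub>m 1) (0\<^sub>m 1 m) Z I = 1\<^sub>m n"
    using n unfolding Z_def I_def by (intro eq_matI) auto
  have V: "V \<in> carrier_mat n n" "V' \<in> carrier_mat n n"
    using four_block_carrier_mat[of "1\<^sub>m 1" 1 1 I m m] ZI n
    unfolding V_def V'_def by auto
  have E: "E \<in> carrier_mat n n"
    using four_block_carrier_mat[of "r \<cdot>\<^sub>m 1\<^sub>m 1" 1 1 D m m] D n unfolding E_def by auto
  have I1: "(1\<^sub>m 1 :: complex mat) \<in> carrier_mat 1 1" "r \<cdot>\<^sub>m 1\<^sub>m 1 \<in> carrier_mat 1 1"
    "- y \<in> carrier_mat 1 m" "(0\<^sub>m 1 m :: complex mat) \<in> carrier_mat 1 m"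
    using y by auto
  have VV: "V' * V = 1\<^sub>m n"
  proof -
    have "1\<^sub>m 1 * 1\<^sub>m 1 + - y * Z = 1\<^sub>m 1" "1\<^sub>m 1 * y + - y * I = 0\<^sub>m 1 m"
      "Z * 1\<^sub>m 1 + I * Z = Z" "Z * y + I * I = I"
      using y unfolding Z_def I_def by auto
    then show ?thesis
      unfolding V_def V'_def
        mult_four_block_mat[OF I1(1,3) ZI I1(1) y ZI] using one by simp
  qed
  have VV': "V * V' = 1\<^sub>m n" by (rule mat_mult_left_right_inverse[OF V(2,1) VV])
  have "V * U = E * V"
  proof -
    have "1\<^sub>m 1 * (r \<cdot>\<^sub>m 1\<^sub>m 1) + y * Z = r \<cdot>\<^sub>m 1\<^sub>m 1" "1\<^sub>m 1 * U2 + y * D = r \<cdot>\<^sub>m y"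
      "Z * (r \<cdot>\<^sub>m 1\<^sub>m 1) + I * Z = Z" "Z * U2 + I * D = D"
      using y blk(2) D yU unfolding Z_def I_def by auto
    moreover have "r \<cdot>\<^sub>m 1\<^sub>m 1 * 1\<^sub>m 1 + 0\<^sub>m 1 m * Z = r \<cdot>\<^sub>m 1\<^sub>m 1"
      "r \<cdot>\<^sub>m 1\<^sub>m 1 * y + 0\<^sub>m 1 m * I = r \<cdot>\<^sub>m y"
      "Z * 1\<^sub>m 1 + D * Z = Z" "Z * y + D * I = D"
      using y D mult_smult_assoc_mat[OF one_carrier_mat y, of r] unfolding Z_def I_def by auto
    ultimately show ?thesis
      unfolding V_def E_def blk(5) U0 U1 Z_def[symmetric]
        mult_four_block_mat[OF I1(1) y ZI I1(2) blk(2) ZI(1) D]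
        mult_four_block_mat[OF I1(2,4) ZI(1) D I1(1) y ZI] by simp
  qed
  then have "V' * E * V = (V' * V) * U"
    using V E w(5) by (simp add: assoc_mult_mat[of _ n n _ n _ n])
  then have U: "V' * E * V = U" using w(5) VV by simp
  \<comment> \<open>The change of basis \<open>V\<close> is composed with the Schur change of basis:
    \<open>S * V'\<close> and \<open>V * T\<close> become \<open>P\<close> and
    \<open>Q\<close>.\<close>
  have "S * V' * (V * T) = S * (V' * V) * T" "V * T * (S * V') = V * (T * S) * V'"
    "S * V' * E * (V * T) = S * (V' * E * V) * T"
    using V E w(5-7) by (simp_all add: assoc_mult_mat[of _ n n _ n _ n])
  then have "(S * V') * (V * T) = 1\<^sub>m n" "(V * T) * (S * V') = 1\<^sub>m n"
    and A': "A = (S * V') * E * (V * T)"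
    unfolding U VV w(2) using w(1,3) VV' right_mult_one_mat[OF w(6)] right_mult_one_mat[OF V(1)]
    by simp_all
  moreover have "S * V' \<in> carrier_mat n n" "V * T \<in> carrier_mat n n"
    using w(6,7) V by auto
  ultimately show thesis
    using that[OF _ _ D _ _ n A'[unfolded E_def Z_def] evD] by blast
qed

text \<open>After conjugation to diag(r, D) and division by \<open>r\<close>, the block
  \<open>D / r\<close> has all eigenvalues inside the unit disc, so its powers vanish. The limit P
  diag(1, 0) Q is the outer product of the first column of \<open>P\<close> and the first row of
  \<open>Q\<close>, which pair to 1 because \<open>Q * P\<close> is the identity.\<close>

lemma simple_dominant_eigenvalue_power_limit:
  assumes M: "M \<in> carrier_mat n n" and dom: "simple_dominant_eigenvalue M r" and r: "r \<noteq> 0"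
  obtains v w where "v \<in> carrier_vec n" "w \<in> carrier_vec n" "w \<bullet> v = 1"
    "mat_lim (\<lambda>k. (1 / r ^ k) \<cdot>\<^sub>m (M ^\<^sub>m k)) (mat n n (\<lambda>(i, j). v $ i * w $ j))"
proof -
  let ?c = complex_of_real
  define A where "A = map_mat ?c M"
  have A: "A \<in> carrier_mat n n" using M unfolding A_def by simp
  have ord: "Polynomial.order (?c r) (char_poly A) = 1"
    and small: "\<And>z. eigenvalue A z \<Longrightarrow> z \<noteq> ?c r \<Longrightarrow> cmod z < \<bar>r\<bar>"
    using dom unfolding simple_dominant_eigenvalue_def A_def Let_def by auto
  obtain m P Q D where PQ: "P \<in> carrier_mat n n" "Q \<in> carrier_mat n n" and D: "D \<in> carrier_mat m m"
    and inv: "P * Q = 1\<^sub>m n" "Q * P = 1\<^sub>m n" and n: "n = Suc m"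
    and AE: "A = P * four_block_mat (?c r \<cdot>\<^sub>m 1\<^sub>m 1) (0\<^sub>m 1 m) (0\<^sub>m m 1) D * Q"
    and evD: "\<And>z. eigenvalue D z \<Longrightarrow> eigenvalue A z \<and> z \<noteq> ?c r"
    by (rule simple_eigenvalue_block_diag[OF A ord]) blast
  define D' where "D' = ?c (1 / r) \<cdot>\<^sub>m D"
  have D': "D' \<in> carrier_mat m m" using D unfolding D'_def by simp
  \<comment> \<open>\<open>F X\<close> is diag(1, X), which commutes with taking powers: convergence
    only has to be checked in the block \<open>X\<close>.\<close>
  define F where "F = (\<lambda>X. four_block_mat (1\<^sub>m 1) (0\<^sub>m 1 m) (0\<^sub>m m 1) X :: complex mat)"
  have F: "F X \<in> carrier_mat n n" if "X \<in> carrier_mat m m" for X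
    using four_block_carrier_mat[of "1\<^sub>m 1" 1 1 X m m] n that unfolding F_def by auto
  have "cmod z < 1" if "eigenvalue D' z" for z
  proof -
    have "eigenvalue D (z / ?c (1 / r))"
      by (rule eigenvalue_smult[OF D]) (use that r in \<open>auto simp: D'_def\<close>)
    from small[of "z / ?c (1 / r)"] evD[OF this] have "cmod z * \<bar>r\<bar> < \<bar>r\<bar>"
      using r by (simp add: norm_divide norm_mult)
    then show ?thesis using r by simp
  qed
  then have limD: "mat_lim (\<lambda>k. D' ^\<^sub>m k) (0\<^sub>m m m)"
    by (rule mat_lim_pow_0[OF D'])
  have limF: "mat_lim (\<lambda>k. F (D' ^\<^sub>m k)) (F (0\<^sub>m m m))"
    unfolding mat_lim_def
  proof (intro allI impI)
    fix i j assume "i < dim_row (F (0\<^sub>m m m))" "j < dim_col (F (0\<^sub>m m m))"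
    then have ij: "i < n" "j < n" using F[of "0\<^sub>m m m"] by auto
    show "(\<lambda>k. F (D' ^\<^sub>m k) $$ (i, j)) \<longlonglongrightarrow> F (0\<^sub>m m m) $$ (i, j)"
    proof (cases "i < 1 \<or> j < 1")
      case True
      then have "F (D' ^\<^sub>m k) $$ (i, j) = F (0\<^sub>m m m) $$ (i, j)" for k
        using ij n D' unfolding F_def by auto
      then show ?thesis by simp
    next
      case False
      then show ?thesis using ij n D' limD unfolding F_def mat_lim_def by auto
    qed
  qed
  have E: "four_block_mat (?c r \<cdot>\<^sub>m 1\<^sub>m 1) (0\<^sub>m 1 m) (0\<^sub>m m 1) D = ?c r \<cdot>\<^sub>m F D'"
    unfolding F_def D'_def using n D r by (intro eq_matI) auto
  have Apow: "?c (1 / r ^ k) \<cdot>\<^sub>m (A ^\<^sub>m k) = P * F (D' ^\<^sub>m k) * Q" for k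
  proof -
    have rF: "?c r \<cdot>\<^sub>m F D' \<in> carrier_mat n n" using F[OF D'] by simp
    have "similar_mat_wit A (?c r \<cdot>\<^sub>m F D') P Q"
      using A rF PQ inv AE unfolding E by (intro similar_mat_witI) auto
    from similar_mat_wit_pow_id[OF this, of k]
    have "A ^\<^sub>m k = P * (?c r ^ k \<cdot>\<^sub>m (F D' ^\<^sub>m k)) * Q"
      by (simp only: pow_mat_smult[OF F[OF D']])
    also have "F D' ^\<^sub>m k = F (D' ^\<^sub>m k)"
      unfolding F_def using pow_four_block_mat[OF one_carrier_mat D', of 1 k] by (simp only: one_pow_mat)
    also have "P * (?c r ^ k \<cdot>\<^sub>m F (D' ^\<^sub>m k)) * Q = ?c r ^ k \<cdot>\<^sub>m (P * F (D' ^\<^sub>m k) * Q)"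
      using mult_smult_distrib[OF PQ(1) F[of "D' ^\<^sub>m k"]]
        mult_smult_assoc_mat[OF mult_carrier_mat[OF PQ(1) F[of "D' ^\<^sub>m k"]] PQ(2)] D' by simp
    finally show ?thesis using r by (intro eq_matI) auto
  qed
  define v0 w0 where "v0 = col P 0" and "w0 = row Q 0"
  define L where "L = P * F (0\<^sub>m m m) * Q"
  have L: "L \<in> carrier_mat n n"
    unfolding L_def by (intro mult_carrier_mat[of _ n n] PQ F zero_carrier_mat)
  have Lij: "L $$ (i, j) = v0 $ i * w0 $ j" if "i < n" "j < n" for i j
  proof -
    have F0: "F (0\<^sub>m m m) $$ (l, p) = (if l = 0 \<and> p = 0 then 1 else 0)" if "l < n" "p < n" for l p
      using that n unfolding F_def by auto
    have "(P * F (0\<^sub>m m m)) $$ (i, l) = (if l = 0 then P $$ (i, 0) else 0)" if l: "l < n" for l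
    proof -
      have "(P * F (0\<^sub>m m m)) $$ (i, l)
          = (\<Sum>p = 0..<n. P $$ (i, p) * F (0\<^sub>m m m) $$ (p, l))"
        using PQ F[of "0\<^sub>m m m"] \<open>i < n\<close> l by (simp add: scalar_prod_def)
      also have "\<dots> = (\<Sum>p = 0..<n. if p = 0 then (if l = 0 then P $$ (i, 0) else 0) else 0)"
        using F0 l by (intro sum.cong) auto
      also have "\<dots> = (if l = 0 then P $$ (i, 0) else 0)" using n by (subst sum.delta) auto
      finally show ?thesis .
    qed
    note PF = this
    define G where "G = P * F (0\<^sub>m m m)"
    have G: "G \<in> carrier_mat n n" unfolding G_def by (intro mult_carrier_mat[of _ n n] PQ F zero_carrier_mat)
    have "L $$ (i, j) = (\<Sum>l = 0..<n. G $$ (i, l) * Q $$ (l, j))"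
      using G PQ(2) that unfolding L_def G_def[symmetric] by (simp add: scalar_prod_def)
    also have "\<dots> = (\<Sum>l = 0..<n. (if l = 0 then P $$ (i, 0) else 0) * Q $$ (l, j))"
      using PF unfolding G_def by (intro sum.cong) auto
    also have "\<dots> = (\<Sum>l = 0..<n. if l = 0 then P $$ (i, 0) * Q $$ (0, j) else 0)"
      by (intro sum.cong) auto
    also have "\<dots> = P $$ (i, 0) * Q $$ (0, j)" using n by (subst sum.delta) auto
    finally show ?thesis using that n PQ unfolding v0_def w0_def by simp
  qed
  have Dk: "D' ^\<^sub>m k \<in> carrier_mat m m" for k using D' by simp
  have limA: "mat_lim (\<lambda>k. ?c (1 / r ^ k) \<cdot>\<^sub>m (A ^\<^sub>m k)) L"
    unfolding Apow L_def using PQ F[OF Dk] F[of "0\<^sub>m m m"]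
    by (intro mat_lim_mult[of _ n n _ n] mat_lim_const limF) auto
  have lim: "(\<lambda>k. ?c (1 / r ^ k * (M ^\<^sub>m k) $$ (i, j))) \<longlonglongrightarrow> L $$ (i, j)" if "i < n" "j < n" for i j
  proof -
    have Mk: "M ^\<^sub>m k \<in> carrier_mat n n" for k using M by simp
    have "A ^\<^sub>m k = map_mat ?c (M ^\<^sub>m k)" for k
      unfolding A_def by (rule of_real_hom.mat_hom_pow[OF M, symmetric])
    then show ?thesis
      using limA that L carrier_matD[OF Mk] unfolding mat_lim_def by simp
  qed
  have limRe: "(\<lambda>k. 1 / r ^ k * (M ^\<^sub>m k) $$ (i, j)) \<longlonglongrightarrow> Re (L $$ (i, j))" if "i < n" "j < n" for i j
    using tendsto_Re[OF lim[OF that]] by simp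
  \<comment> \<open>\<open>P\<close> and \<open>Q\<close> may be complex, but \<open>L\<close> is a
    limit of real matrices, so its entries are real.\<close>
  have real: "?c (Re (L $$ (i, j))) = L $$ (i, j)" if "i < n" "j < n" for i j
    using LIMSEQ_unique[OF tendsto_of_real[OF limRe[OF that]] lim[OF that]] by simp
  have "(Q * P) $$ (0, 0) = 1" using inv n by simp
  then have wv: "(\<Sum>i = 0..<n. w0 $ i * v0 $ i) = 1"
    using PQ n unfolding v0_def w0_def by (simp add: scalar_prod_def)
  \<comment> \<open>The diagonal entries of \<open>L\<close> sum to 1, so one of them is nonzero; it
    serves as the divisor in the real factorisation.\<close>
  then obtain j0 where j0: "j0 < n" "w0 $ j0 * v0 $ j0 \<noteq> 0"
    by (metis (no_types, lifting) atLeastLessThan_iff sum.neutral zero_neq_one)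
  \<comment> \<open>\<open>v0\<close> and \<open>w0\<close> are complex; a nonzero column and the rescaled row of the real matrix \<open>L\<close> replace them.\<close>
  define v w where "v = vec n (\<lambda>i. Re (L $$ (i, j0)))"
    and "w = vec n (\<lambda>j. Re (L $$ (j0, j)) / Re (L $$ (j0, j0)))"
  have vw: "v $ i * w $ j = Re (L $$ (i, j))" if ij: "i < n" "j < n" for i j
  proof -
    have "?c (v $ i * w $ j) = L $$ (i, j0) * L $$ (j0, j) / L $$ (j0, j0)"
      using ij j0 unfolding v_def w_def by (simp add: real)
    also have "\<dots> = L $$ (i, j)" using ij j0 by (simp add: Lij)
    finally show ?thesis by (metis Re_complex_of_real)
  qed
  have "w \<bullet> v = (\<Sum>i = 0..<n. v $ i * w $ i)"
    unfolding scalar_prod_def by (simp add: v_def mult.commute)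
  also have "\<dots> = Re (\<Sum>i = 0..<n. w0 $ i * v0 $ i)" 
    by (simp add: vw Lij mult.commute del: times_complex.sel)
  finally have "w \<bullet> v = 1" unfolding wv by simp
  moreover have "mat_lim (\<lambda>k. (1 / r ^ k) \<cdot>\<^sub>m (M ^\<^sub>m k)) (mat n n (\<lambda>(i, j). v $ i * w $ j))"
  proof -
    have Mk: "M ^\<^sub>m k \<in> carrier_mat n n" for k using M by simp
    show ?thesis using limRe carrier_matD[OF Mk] unfolding mat_lim_def by (simp add: vw)
  qed
  ultimately show thesis using that[of v w] unfolding v_def w_def by simp
qed

section \<open>Rational approximation and positive vectors\<close>

lemma mat_lim_eventually_pos:
  fixes Y :: "real mat"
  assumes "mat_lim X Y" "\<And>i j. i < dim_row Y \<Longrightarrow> j < dim_col Y \<Longrightarrow> Y $$ (i, j) > 0"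
  shows "\<forall>\<^sub>F k in sequentially. \<forall>i < dim_row Y. \<forall>j < dim_col Y. X k $$ (i, j) > 0"
proof -
  have "\<forall>\<^sub>F k in sequentially. \<forall>i \<in> {..<dim_row Y}. \<forall>j \<in> {..<dim_col Y}. X k $$ (i, j) > 0"
    using assms unfolding mat_lim_def
    by (intro eventually_ball_finite ballI finite_lessThan order_tendstoD(1)) auto
  then show ?thesis by (rule eventually_mono) auto
qed

text \<open>Density of the rationals is phrased with sequences so that it can be fed into
  \<open>mat_lim\<close>.\<close>

lemma Rats_sequence:
  obtains f :: "nat \<Rightarrow> real" where "\<And>k. f k \<in> \<rat>" "f \<longlonglongrightarrow> x"
proof -
  have "\<exists>y \<in> \<rat>. x < y \<and> y < x + 1 / Suc k" for k :: nat
    by (rule Rats_dense_in_real) simp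
  then obtain f where f: "\<And>k. f k \<in> \<rat> \<and> x < f k \<and> f k < x + 1 / Suc k" by metis
  have "f \<longlonglongrightarrow> x"
  proof (rule real_tendsto_sandwich[of "\<lambda>_. x" _ _ "\<lambda>k. x + 1 / Suc k"])
    show "(\<lambda>k. x + 1 / Suc k) \<longlonglongrightarrow> x"
      using tendsto_add[OF tendsto_const[of x] LIMSEQ_Suc[OF lim_1_over_n]] by simp
  qed (use f in \<open>auto intro!: always_eventually less_imp_le\<close>)
  then show thesis using f that by blast
qed

lemma Rats_vec_sequence:
  fixes x :: "real vec"
  assumes x: "x \<in> carrier_vec n"
  obtains f where "\<And>k. f k \<in> carrier_vec n" "\<And>k i. i < n \<Longrightarrow> f k $ i \<in> \<rat>"
    "\<And>i. i < n \<Longrightarrow> (\<lambda>k. f k $ i) \<longlonglongrightarrow> x $ i"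
proof -
  have "\<forall>i. \<exists>f. (\<forall>k. f k \<in> \<rat>) \<and> f \<longlonglongrightarrow> x $ i" by (metis Rats_sequence)
  then obtain g where g: "\<And>i k. g i k \<in> \<rat>" "\<And>i. g i \<longlonglongrightarrow> x $ i" by metis
  then show thesis using that[of "\<lambda>k. vec n (\<lambda>i. g i k)"] by simp
qed

text \<open>The all-ones vector and its sum with the \<open>i\<close>-th unit vector are both
  positive, and their products with \<open>a\<close> differ by \<open>a $ i\<close>. If that entry
  is nonzero, the two products cannot both vanish.\<close>

lemma pos_vec_scalar_prod_nonzero:
  fixes a :: "real vec"
  assumes a: "a \<in> carrier_vec n" "a \<noteq> 0\<^sub>v n"
  obtains p where "p \<in> carrier_vec n" "\<And>i. i < n \<Longrightarrow> p $ i > 0" "a \<bullet> p \<noteq> 0"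
proof -
  define j1 where "j1 = vec n (\<lambda>_. 1 :: real)"
  obtain i where i: "i < n" "a $ i \<noteq> 0" using a by (metis eq_vecI carrier_vecD index_zero_vec)
  define p where "p = j1 + unit_vec n i"
  have "a \<bullet> p = a \<bullet> j1 + a $ i"
    unfolding p_def using a i by (simp add: scalar_prod_add_distrib[of _ n] j1_def)
  then have "a \<bullet> p \<noteq> 0 \<or> a \<bullet> j1 \<noteq> 0" using i by auto
  moreover have "p $ k > 0" "j1 $ k > 0" if "k < n" for k
    using that i unfolding p_def j1_def by (auto simp: unit_vec_def)
  moreover have "p \<in> carrier_vec n" "j1 \<in> carrier_vec n" unfolding p_def j1_def by auto
  ultimately show thesis using that by blast
qed

text \<open>Reduces positivity of the conjugated rank one limit to positivity of two
  vectors.\<close>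

lemma rank_one_sandwich:
  fixes v w :: "'a::comm_ring_1 vec"
  assumes A: "A \<in> carrier_mat n n" and B: "B \<in> carrier_mat n n"
    and v: "v \<in> carrier_vec n" and w: "w \<in> carrier_vec n"
  shows "A * mat n n (\<lambda>(i, j). v $ i * w $ j) * B
    = mat n n (\<lambda>(i, j). (A *\<^sub>v v) $ i * (transpose_mat B *\<^sub>v w) $ j)"
proof (rule eq_matI)
  define G where "G = A * mat n n (\<lambda>(i, j). v $ i * w $ j)"
  have G: "G \<in> carrier_mat n n" using A unfolding G_def by auto
  fix i j assume "i < dim_row (mat n n (\<lambda>(i, j). (A *\<^sub>v v) $ i * (transpose_mat B *\<^sub>v w) $ j))"
    "j < dim_col (mat n n (\<lambda>(i, j). (A *\<^sub>v v) $ i * (transpose_mat B *\<^sub>v w) $ j))"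
  then have ij: "i < n" "j < n" by auto
  have Gij: "G $$ (i, l) = (A *\<^sub>v v) $ i * w $ l" if "l < n" for l
    using A v ij that unfolding G_def by (simp add: scalar_prod_def sum_distrib_right mult.assoc)
  have "(G * B) $$ (i, j) = (\<Sum>l = 0..<n. G $$ (i, l) * B $$ (l, j))"
    using G B ij by (simp add: scalar_prod_def)
  also have "\<dots> = (A *\<^sub>v v) $ i * (\<Sum>l = 0..<n. B $$ (l, j) * w $ l)"
    unfolding sum_distrib_left by (intro sum.cong) (auto simp: Gij)
  also have "(\<Sum>l = 0..<n. B $$ (l, j) * w $ l) = (transpose_mat B *\<^sub>v w) $ j"
    using B w ij by (simp add: scalar_prod_def)
  finally show "(A * mat n n (\<lambda>(i, j). v $ i * w $ j) * B) $$ (i, j)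
    = mat n n (\<lambda>(i, j). (A *\<^sub>v v) $ i * (transpose_mat B *\<^sub>v w) $ j) $$ (i, j)"
    using ij unfolding G_def by simp
qed (use A B in auto)

text \<open>Unit vectors recover the entries, so matrix identities can be verified by computing with
  vectors.\<close>

lemma bilinear_mat_eqI:
  fixes A B :: "'a::comm_ring_1 mat"
  assumes A: "A \<in> carrier_mat n n" and B: "B \<in> carrier_mat n n"
    and eq: "\<And>x y. x \<in> carrier_vec n \<Longrightarrow> y \<in> carrier_vec n \<Longrightarrow> x \<bullet> (A *\<^sub>v y) = x \<bullet> (B *\<^sub>v y)"
  shows "A = B"
proof (rule eq_matI)
  fix i j assume ij: "i < dim_row B" "j < dim_col B"
  have unit: "unit_vec n i \<bullet> (C *\<^sub>v unit_vec n j) = C $$ (i, j)" if C: "C \<in> carrier_mat n n" for C :: "'a mat"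
  proof -
    have ij': "i < n" "j < n" using ij B by auto
    have u: "unit_vec n i \<bullet> (C *\<^sub>v unit_vec n j) = (C *\<^sub>v unit_vec n j) $ i"
      by (rule scalar_prod_left_unit[OF mult_mat_vec_carrier[OF C unit_vec_carrier] ij'(1)])
    show ?thesis unfolding u using C ij' by simp
  qed
  then show "A $$ (i, j) = B $$ (i, j)"
    using eq[of "unit_vec n i" "unit_vec n j"] A B by simp
qed (use A B in auto)

section \<open>Entries of matrix products\<close>

lemma sum_closed:
  assumes "0 \<in> S" "\<And>x y. x \<in> S \<Longrightarrow> y \<in> S \<Longrightarrow> x + y \<in> S" "\<And>x. x \<in> X \<Longrightarrow> f x \<in> S"
  shows "sum f X \<in> S"
  using assms(3) by (induction X rule: infinite_finite_induct) (auto intro: assms(1,2))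

text \<open>The set \<open>S\<close> is kept abstract because both \<rat> and \<int> are substituted
  for it.\<close>

lemma elements_mat_mult_subset:
  fixes A B :: "'a::semiring_1 mat"
  assumes A: "A \<in> carrier_mat nr n" "elements_mat A \<subseteq> S"
    and B: "B \<in> carrier_mat n nc" "elements_mat B \<subseteq> S"
    and S: "0 \<in> S" "\<And>x y. x \<in> S \<Longrightarrow> y \<in> S \<Longrightarrow> x + y \<in> S" "\<And>x y. x \<in> S \<Longrightarrow> y \<in> S \<Longrightarrow> x * y \<in> S"
  shows "elements_mat (A * B) \<subseteq> S"
proof
  fix a assume "a \<in> elements_mat (A * B)"
  then obtain i j where ij: "i < nr" "j < nc" and a: "a = (A * B) $$ (i, j)"
    using A B by auto
  have "A $$ (i, l) * B $$ (l, j) \<in> S" if "l < n" for l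
    using S(3) A(2) B(2) elements_matI[OF A(1) ij(1) that refl] elements_matI[OF B(1) that ij(2) refl]
    by blast
  then have "(\<Sum>l = 0..<n. A $$ (i, l) * B $$ (l, j)) \<in> S"
    using S(1,2) by (intro sum_closed) auto
  then show "a \<in> S" unfolding a using A B ij by (simp add: scalar_prod_def)
qed

section \<open>Symplectic transvections\<close>

locale symplectic =
  fixes m :: nat and L :: "real mat"
  assumes form: "symplectic_form m L"
begin

lemma L: "L \<in> carrier_mat m m"
  using form unfolding symplectic_form_def by auto

abbreviation om :: "real vec \<Rightarrow> real vec \<Rightarrow> real" where
  "om x y \<equiv> x \<bullet> (L *\<^sub>v y)"

lemma skew: "x \<in> carrier_vec m \<Longrightarrow> y \<in> carrier_vec m \<Longrightarrow> om x y = - om y x"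
  using form unfolding symplectic_form_def by blast

lemma om_self: "x \<in> carrier_vec m \<Longrightarrow> om x x = 0"
  using skew[of x x] by linarith

lemma om_add_left:
  "x \<in> carrier_vec m \<Longrightarrow> y \<in> carrier_vec m \<Longrightarrow> z \<in> carrier_vec m \<Longrightarrow> om (x + y) z = om x z + om y z"
  using L by (simp add: add_scalar_prod_distrib[of _ m])

lemma om_smult_left:
  "x \<in> carrier_vec m \<Longrightarrow> z \<in> carrier_vec m \<Longrightarrow> om (a \<cdot>\<^sub>v x) z = a * om x z"
  using L by (simp add: smult_scalar_prod_distrib[of _ m])

lemma om_add_right:
  "x \<in> carrier_vec m \<Longrightarrow> y \<in> carrier_vec m \<Longrightarrow> z \<in> carrier_vec m \<Longrightarrow> om z (x + y) = om z x + om z y"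
  using skew[of z "x + y"] skew[of z x] skew[of z y] om_add_left[of x y z] by simp

lemma om_smult_right:
  "x \<in> carrier_vec m \<Longrightarrow> z \<in> carrier_vec m \<Longrightarrow> om z (a \<cdot>\<^sub>v x) = a * om z x"
  using skew[of z "a \<cdot>\<^sub>v x"] skew[of z x] om_smult_left[of x z a] by simp

text \<open>Non-degeneracy is given for the left argument, whereas a kernel vector of
  \<open>L\<close> annihilates the form from the right; skew-symmetry exchanges the two.\<close>

lemma det_L: "det L \<noteq> 0"
proof
  assume "det L = 0"
  then obtain y where y: "y \<in> carrier_vec m" "y \<noteq> 0\<^sub>v m" "L *\<^sub>v y = 0\<^sub>v m"
    using det_0_iff_vec_prod_zero[OF L] by auto
  have "om y x = 0" if "x \<in> carrier_vec m" for x
    using skew[OF y(1) that] y(3) that by simp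
  then show False using form y unfolding symplectic_form_def by blast
qed

text \<open>The matrix I + c d (L d)^T of the symplectic transvection along \<open>d\<close>. Scale
  \<open>c\<close> and direction \<open>d\<close> are independent parameters, both of which will be
  perturbed.\<close>

definition transvection :: "real \<Rightarrow> real vec \<Rightarrow> real mat" where
  "transvection c d = mat m m (\<lambda>(i, j). (if i = j then 1 else 0) + c * d $ i * (L *\<^sub>v d) $ j)"

lemma transvection_carrier [simp]: "transvection c d \<in> carrier_mat m m"
  unfolding transvection_def by simp

lemma transvection_apply:
  assumes x: "x \<in> carrier_vec m" and d: "d \<in> carrier_vec m"
  shows "transvection c d *\<^sub>v x = x + (c * om x d) \<cdot>\<^sub>v d"
proof (rule eq_vecI)
  fix i assume "i < dim_vec (x + (c * om x d) \<cdot>\<^sub>v d)"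
  then have i: "i < m" using d by simp
  have "(transvection c d *\<^sub>v x) $ i
      = (\<Sum>j = 0..<m. ((if i = j then 1 else 0) + c * d $ i * (L *\<^sub>v d) $ j) * x $ j)"
    using x i unfolding transvection_def by (simp add: scalar_prod_def)
  also have "\<dots> = (\<Sum>j = 0..<m. (if i = j then x $ j else 0) + c * d $ i * (x $ j * (L *\<^sub>v d) $ j))"
    by (intro sum.cong) (auto simp: algebra_simps)
  also have "\<dots> = x $ i + c * d $ i * (\<Sum>j = 0..<m. x $ j * (L *\<^sub>v d) $ j)"
    using i by (simp add: sum.distrib sum_distrib_left del: index_mult_mat_vec)
  also have "(\<Sum>j = 0..<m. x $ j * (L *\<^sub>v d) $ j) = om x d"
    using L by (simp add: scalar_prod_def[of x])
  finally show "(transvection c d *\<^sub>v x) $ i = (x + (c * om x d) \<cdot>\<^sub>v d) $ i"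
    using i x d by simp
qed (use d in \<open>simp add: transvection_def\<close>)

text \<open>Since \<open>om d d = 0\<close>, adding a multiple of \<open>d\<close> does not change
  \<open>om y d\<close>, so the two shifts along \<open>d\<close> are opposite and cancel.\<close>

lemma transvection_inverse:
  assumes d: "d \<in> carrier_vec m"
  shows "transvection c d * transvection (- c) d = 1\<^sub>m m"
proof (rule bilinear_mat_eqI[of _ m])
  fix x y :: "real vec" assume xy: "x \<in> carrier_vec m" "y \<in> carrier_vec m"
  define s where "s = - c * om y d"
  have sd: "s \<cdot>\<^sub>v d \<in> carrier_vec m" using d by simp
  have "(transvection c d * transvection (- c) d) *\<^sub>v y = transvection c d *\<^sub>v (y + s \<cdot>\<^sub>v d)"
    unfolding assoc_mult_mat_vec[OF transvection_carrier transvection_carrier xy(2)]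
      transvection_apply[OF xy(2) d] s_def ..
  also have "\<dots> = (y + s \<cdot>\<^sub>v d) + (c * om y d) \<cdot>\<^sub>v d"
    unfolding transvection_apply[OF add_carrier_vec[OF xy(2) sd] d]
      om_add_left[OF xy(2) sd d] om_smult_left[OF d d] om_self[OF d] by simp
  also have "\<dots> = y"
    using xy d by (intro eq_vecI) (auto simp: s_def)
  finally have "(transvection c d * transvection (- c) d) *\<^sub>v y = y" .
  then show "x \<bullet> ((transvection c d * transvection (- c) d) *\<^sub>v y) = x \<bullet> (1\<^sub>m m *\<^sub>v y)"
    using xy by simp
qed (auto intro: mult_carrier_mat[of _ m m])

text \<open>Moves the matrix equation to an invariance property of \<open>om\<close>, where
  bilinearity and skew-symmetry can be applied.\<close>

lemma preserves_iff:
  assumes A: "A \<in> carrier_mat m m"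
  shows "transpose_mat A * L * A = L \<longleftrightarrow>
    (\<forall>x \<in> carrier_vec m. \<forall>y \<in> carrier_vec m. om (A *\<^sub>v x) (A *\<^sub>v y) = om x y)"
proof -
  have eq: "om (A *\<^sub>v x) (A *\<^sub>v y) = x \<bullet> ((transpose_mat A * L * A) *\<^sub>v y)"
    if xy: "x \<in> carrier_vec m" "y \<in> carrier_vec m" for x y
  proof -
    have z: "L *\<^sub>v (A *\<^sub>v y) \<in> carrier_vec m" "transpose_mat A *\<^sub>v (L *\<^sub>v (A *\<^sub>v y)) \<in> carrier_vec m"
      "A *\<^sub>v x \<in> carrier_vec m"
      using A L xy by auto
    have "(transpose_mat A * L * A) *\<^sub>v y = transpose_mat A *\<^sub>v (L *\<^sub>v (A *\<^sub>v y))"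
      using A L xy by (simp add: assoc_mult_mat_vec[of _ m m _ m])
    then show ?thesis
      using transpose_vec_mult_scalar[OF A xy(1) z(1)]
      by (simp only: comm_scalar_prod[OF z(1,3)] comm_scalar_prod[OF z(2) xy(1)])
  qed
  show ?thesis
  proof
    assume "transpose_mat A * L * A = L"
    then show "\<forall>x \<in> carrier_vec m. \<forall>y \<in> carrier_vec m. om (A *\<^sub>v x) (A *\<^sub>v y) = om x y"
      using eq by simp
  next
    assume "\<forall>x \<in> carrier_vec m. \<forall>y \<in> carrier_vec m. om (A *\<^sub>v x) (A *\<^sub>v y) = om x y"
    then show "transpose_mat A * L * A = L"
      using eq A L by (intro bilinear_mat_eqI[of _ m]) (auto intro!: mult_carrier_mat[of _ m m])
  qed
qed

text \<open>On expanding the form, the two cross terms cancel by skew-symmetry and the quadratic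
  term contains \<open>om d d = 0\<close>.\<close>

lemma transvection_preserves:
  assumes d: "d \<in> carrier_vec m"
  shows "transpose_mat (transvection c d) * L * transvection c d = L"
  unfolding preserves_iff[OF transvection_carrier]
proof (intro ballI)
  fix x y :: "real vec" assume xy: "x \<in> carrier_vec m" "y \<in> carrier_vec m"
  define a b where "a = om x d" and "b = om y d"
  have dy: "om d y = - b" using skew[OF d xy(2)] unfolding b_def .
  have z: "(c * a) \<cdot>\<^sub>v d \<in> carrier_vec m" "(c * b) \<cdot>\<^sub>v d \<in> carrier_vec m" using d by auto
  have "om (transvection c d *\<^sub>v x) (transvection c d *\<^sub>v y) = om (x + (c * a) \<cdot>\<^sub>v d) (y + (c * b) \<cdot>\<^sub>v d)"
    using xy d unfolding a_def b_def by (simp only: transvection_apply)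
  also have "\<dots> = om x y + c * a * om d y + c * b * (om x d + c * a * om d d)"
    using xy d z by (simp only: om_add_left om_add_right om_smult_left om_smult_right add_carrier_vec)
  also have "\<dots> = om x y" unfolding om_self[OF d] dy a_def[symmetric] by (simp add: algebra_simps)
  finally show "om (transvection c d *\<^sub>v x) (transvection c d *\<^sub>v y) = om x y" .
qed

lemma preserves_mult:
  assumes "A \<in> carrier_mat m m" "B \<in> carrier_mat m m"
    and "transpose_mat A * L * A = L" "transpose_mat B * L * B = L"
  shows "transpose_mat (A * B) * L * (A * B) = L"
proof -
  have AB: "A * B \<in> carrier_mat m m" using assms by simp
  show ?thesis
    unfolding preserves_iff[OF AB]
    using assms(3,4)[unfolded preserves_iff[OF assms(1)] preserves_iff[OF assms(2)]]
    by (simp add: assoc_mult_mat_vec[OF assms(1,2)] mult_mat_vec_carrier[OF assms(2)])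
qed

text \<open>The direction is y - x. As \<open>om x x = 0\<close>, the form of \<open>x\<close> with
  this direction is \<open>om x y\<close>, and dividing by it makes the shift exactly y - x.\<close>

lemma transvection_maps:
  assumes x: "x \<in> carrier_vec m" and y: "y \<in> carrier_vec m" and xy: "om x y \<noteq> 0"
  shows "transvection (1 / om x y) (y + (- 1) \<cdot>\<^sub>v x) *\<^sub>v x = y"
proof -
  have mx: "(- 1) \<cdot>\<^sub>v x \<in> carrier_vec m" using x by simp
  have "om x (y + (- 1) \<cdot>\<^sub>v x) = om x y"
    unfolding om_add_right[OF y mx x] om_smult_right[OF x x] om_self[OF x] by simp
  then show ?thesis
    unfolding transvection_apply[OF x add_carrier_vec[OF y mx]] using x y xy
    by (intro eq_vecI) auto
qed

lemma transvection_fixes: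
  assumes "x \<in> carrier_vec m" "d \<in> carrier_vec m" "om x d = 0"
  shows "transvection c d *\<^sub>v x = x"
  using assms by (simp add: transvection_apply) (intro eq_vecI; simp)

text \<open>For a symplectic \<open>A\<close> with inverse \<open>B\<close> and
  \<open>w = L u\<close>, invariance gives w . (B x) = om (B x) u = om x (A u), so B^T w = L (A u).
  Both conditions thus concern the images of \<open>v\<close> and \<open>u\<close> under
  \<open>A\<close>. The parameters are exposed, not just the products, so that they can be
  approximated later.\<close>

lemma transvections_make_positive:
  assumes v: "v \<in> carrier_vec m" and w: "w \<in> carrier_vec m" and wv: "w \<bullet> v = 1"
  obtains c1 d1 c2 d2 where "d1 \<in> carrier_vec m" "d2 \<in> carrier_vec m"
    "\<And>i. i < m \<Longrightarrow> ((transvection c2 d2 * transvection c1 d1) *\<^sub>v v) $ i > 0"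
    "\<And>i. i < m \<Longrightarrow>
       (transpose_mat (transvection (- c1) d1 * transvection (- c2) d2) *\<^sub>v w) $ i > 0"
proof -
  obtain Li where Li: "Li \<in> carrier_mat m m" "L * Li = 1\<^sub>m m"
    using det_nonzero_inverse[OF L det_L] by metis
  have LLi: "L *\<^sub>v (Li *\<^sub>v x) = x" if "x \<in> carrier_vec m" for x
    using assoc_mult_mat_vec[OF L Li(1) that] Li(2) that by simp
  have LiC: "Li *\<^sub>v x \<in> carrier_vec m" if "x \<in> carrier_vec m" for x
    using Li(1) that by simp
  have LC: "L *\<^sub>v x \<in> carrier_vec m" if "x \<in> carrier_vec m" for x
    using L that by simp
  \<comment> \<open>In dimension 0 the product \<open>w \<bullet> v\<close> would be an empty sum.
    Positivity of \<open>m\<close> makes the sum defining \<open>s\<close> nonempty.\<close>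
  have m: "m > 0"
  proof (rule ccontr)
    assume "\<not> m > 0"
    then show False using wv v w by (simp add: scalar_prod_def)
  qed
  define u where "u = Li *\<^sub>v w"
  have u: "u \<in> carrier_vec m" "L *\<^sub>v u = w" using LLi[OF w] LiC[OF w] unfolding u_def by auto
  have vu: "om v u = 1" unfolding u(2) using wv comm_scalar_prod[OF v w] by simp
  have "L *\<^sub>v v \<noteq> 0\<^sub>v m"
  proof
    assume *: "L *\<^sub>v v = 0\<^sub>v m"
    have "om u v = 0" unfolding * using u by simp
    then show False using skew[OF u(1) v] vu by simp
  qed
  then obtain p where p: "p \<in> carrier_vec m" "\<And>i. i < m \<Longrightarrow> p $ i > 0" "(L *\<^sub>v v) \<bullet> p \<noteq> 0"
    using pos_vec_scalar_prod_nonzero[OF LC[OF v]] by metis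
  have vp: "om v p \<noteq> 0"
    using p(3) skew[OF v p(1)] comm_scalar_prod[OF p(1) LC[OF v]] by simp
  \<comment> \<open>The first transvection moves \<open>v\<close> to \<open>p\<close>; the second fixes \<open>p\<close> because \<open>om p u1 = om p u2 = 1\<close>.\<close>
  define c1 d1 where "c1 = 1 / om v p" and "d1 = p + (- 1) \<cdot>\<^sub>v v"
  have d1: "d1 \<in> carrier_vec m" using p v unfolding d1_def by simp
  define T1 where "T1 = transvection c1 d1"
  have T1: "T1 \<in> carrier_mat m m" "transpose_mat T1 * L * T1 = L" "T1 *\<^sub>v v = p"
    unfolding T1_def using transvection_preserves[OF d1] transvection_maps[OF v p(1) vp]
    by (auto simp: c1_def d1_def)
  define u1 where "u1 = T1 *\<^sub>v u"
  have u1: "u1 \<in> carrier_vec m" using T1 u unfolding u1_def by simp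
  have pu1: "om p u1 = 1"
    using T1(2)[unfolded preserves_iff[OF T1(1)]] v u vu unfolding u1_def T1(3)[symmetric] by auto
  have "u1 \<noteq> 0\<^sub>v m"
  proof
    assume u10: "u1 = 0\<^sub>v m"
    have "om u1 p = 0" unfolding u10 using LC[OF p(1)] by simp
    then show False using skew[OF u1 p(1)] pu1 by simp
  qed
  \<comment> \<open>\<open>q0\<close> is the target for L (A u) up to scale. Its product with
    \<open>u1\<close> must be nonzero for the second transvection to exist; dividing by
    \<open>s\<close> then gives \<open>p \<bullet> q = 1\<close>, the value matching
    \<open>om p u1 = 1\<close>.\<close>
  then obtain q0 where q0: "q0 \<in> carrier_vec m" "\<And>i. i < m \<Longrightarrow> q0 $ i > 0" "u1 \<bullet> q0 \<noteq> 0"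
    using pos_vec_scalar_prod_nonzero[OF u1] by metis
  define s where "s = p \<bullet> q0"
  have s: "s > 0" unfolding s_def scalar_prod_def using p(2) q0(1,2) m
    by (intro sum_pos) auto
  define q where "q = (1 / s) \<cdot>\<^sub>v q0"
  have q: "q \<in> carrier_vec m" "\<And>i. i < m \<Longrightarrow> q $ i > 0" "p \<bullet> q = 1" "u1 \<bullet> q \<noteq> 0"
    using q0 s p(1) u1 unfolding q_def by (auto simp: s_def[symmetric])
  define u2 where "u2 = Li *\<^sub>v q"
  have u2: "u2 \<in> carrier_vec m" "L *\<^sub>v u2 = q" using LLi[OF q(1)] LiC[OF q(1)] unfolding u2_def by auto
  have u12: "om u1 u2 \<noteq> 0" using q(4) unfolding u2(2) .
  define c2 d2 where "c2 = 1 / om u1 u2" and "d2 = u2 + (- 1) \<cdot>\<^sub>v u1"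
  have d2: "d2 \<in> carrier_vec m" using u1 u2 unfolding d2_def by simp
  define T2 where "T2 = transvection c2 d2"
  have mu1: "(- 1) \<cdot>\<^sub>v u1 \<in> carrier_vec m" using u1 by simp
  have "om p d2 = 0"
    unfolding d2_def om_add_right[OF u2(1) mu1 p(1)] om_smult_right[OF u1 p(1)] pu1 u2(2) q(3) by simp
  then have T2: "T2 \<in> carrier_mat m m" "transpose_mat T2 * L * T2 = L" "T2 *\<^sub>v p = p" "T2 *\<^sub>v u1 = u2"
    unfolding T2_def using transvection_preserves[OF d2] transvection_maps[OF u1 u2(1) u12]
      transvection_fixes[OF p(1) d2]
    by (auto simp: c2_def d2_def)
  define A B where "A = T2 * T1" and "B = transvection (- c1) d1 * transvection (- c2) d2"
  have AB: "A \<in> carrier_mat m m" "B \<in> carrier_mat m m"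
    unfolding A_def B_def using T1 T2 mult_carrier_mat[OF transvection_carrier transvection_carrier] by auto
  have Av: "A *\<^sub>v v = p" "A *\<^sub>v u = u2"
    using T2 T1 v u unfolding A_def u1_def by (simp_all add: assoc_mult_mat_vec[OF T2(1) T1(1)])
  have ABx: "A *\<^sub>v (B *\<^sub>v x) = x" if x: "x \<in> carrier_vec m" for x
  proof -
    note t = transvection_carrier
    have inv: "transvection c d *\<^sub>v (transvection (- c) d *\<^sub>v y) = y"
      if "d \<in> carrier_vec m" "y \<in> carrier_vec m" for c d y
      using assoc_mult_mat_vec[OF t[of c d] t[of "- c" d] that(2)] that
      by (simp only: transvection_inverse one_mult_mat_vec)
    have tx: "transvection c d *\<^sub>v y \<in> carrier_vec m" if "y \<in> carrier_vec m" for c d y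
      using mult_mat_vec_carrier[OF t that] .
    show ?thesis
      unfolding A_def B_def T1_def T2_def
        assoc_mult_mat_vec[OF t t x]
        assoc_mult_mat_vec[OF t t tx[OF tx[OF x]]]
        inv[OF d1 tx[OF x]] inv[OF d2 x] ..
  qed
  have Aform: "transpose_mat A * L * A = L"
    unfolding A_def by (rule preserves_mult[OF T2(1) T1(1) T2(2) T1(2)])
  have "transpose_mat B *\<^sub>v w = q"
  proof (rule eq_vecI)
    fix i assume "i < dim_vec q"
    then have i: "i < m" using q by simp
    let ?e = "unit_vec m i :: real vec"
    have e: "?e \<in> carrier_vec m" by simp
    have Be: "B *\<^sub>v ?e \<in> carrier_vec m" using AB e by simp
    have "(transpose_mat B *\<^sub>v w) \<bullet> ?e = w \<bullet> (B *\<^sub>v ?e)"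
      by (rule transpose_vec_mult_scalar[OF AB(2) e w])
    also have "\<dots> = om (B *\<^sub>v ?e) u"
      unfolding u(2) by (rule comm_scalar_prod[OF w Be])
    also have "\<dots> = om (A *\<^sub>v (B *\<^sub>v ?e)) (A *\<^sub>v u)"
      using Aform[unfolded preserves_iff[OF AB(1)]] Be u(1) by metis
    also have "\<dots> = ?e \<bullet> q" unfolding ABx[OF e] Av(2) u2(2) ..
    finally show "(transpose_mat B *\<^sub>v w) $ i = q $ i" using i q(1) by simp
  qed (use AB q in auto)
  then show thesis
    using that[OF d1 d2, of c2 c1] Av(1) p(2) q(2) unfolding A_def B_def T1_def T2_def by simp
qed

section \<open>Rational symplectic matrices\<close>

definition rational_symplectic :: "real mat \<Rightarrow> bool" where
  "rational_symplectic A \<longleftrightarrow>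
     A \<in> carrier_mat m m \<and> elements_mat A \<subseteq> \<rat> \<and> transpose_mat A * L * A = L"

lemma rational_symplectic_transvection:
  assumes LQ: "elements_mat L \<subseteq> \<rat>" and d: "d \<in> carrier_vec m"
    and c: "c \<in> \<rat>" and dQ: "\<And>i. i < m \<Longrightarrow> d $ i \<in> \<rat>"
  shows "rational_symplectic (transvection c d)"
proof -
  have "(L *\<^sub>v d) $ j \<in> \<rat>" if j: "j < m" for j
  proof -
    have "L $$ (j, l) \<in> \<rat>" if "l < m" for l using LQ elements_matI[OF L j that refl] by blast
    then show ?thesis using L d dQ j by (auto simp: scalar_prod_def intro!: Rats_sum Rats_mult)
  qed
  then have "elements_mat (transvection c d) \<subseteq> \<rat>"
    using c dQ by (auto simp: transvection_def intro!: Rats_add Rats_mult dest!: elements_matD)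
  then show ?thesis
    using transvection_preserves[OF d] unfolding rational_symplectic_def by simp
qed

lemma rational_symplectic_mult:
  assumes "rational_symplectic A" "rational_symplectic B"
  shows "rational_symplectic (A * B)"
proof -
  have AB: "A \<in> carrier_mat m m" "B \<in> carrier_mat m m"
    using assms unfolding rational_symplectic_def by auto
  have "elements_mat (A * B) \<subseteq> \<rat>"
    using assms unfolding rational_symplectic_def
    by (intro elements_mat_mult_subset[of _ m m _ _ m]) auto
  then show ?thesis using assms preserves_mult AB unfolding rational_symplectic_def by auto
qed

lemma mat_lim_transvection:
  assumes "\<And>k. dk k \<in> carrier_vec m" "d \<in> carrier_vec m" "ck \<longlonglongrightarrow> c"
    and "\<And>i. i < m \<Longrightarrow> (\<lambda>k. dk k $ i) \<longlonglongrightarrow> d $ i"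
  shows "mat_lim (\<lambda>k. transvection (ck k) (dk k)) (transvection c d)"
proof -
  have "(\<lambda>k. (L *\<^sub>v dk k) $ j) \<longlonglongrightarrow> (L *\<^sub>v d) $ j" if j: "j < m" for j
  proof -
    have eq: "(L *\<^sub>v x) $ j = (\<Sum>l = 0..<m. L $$ (j, l) * x $ l)" if "x \<in> carrier_vec m" for x
      using L that j by (simp add: scalar_prod_def)
    show ?thesis unfolding eq[OF assms(1)] eq[OF assms(2)]
      by (intro tendsto_sum tendsto_mult tendsto_const assms(4)) simp
  qed
  then show ?thesis
    unfolding mat_lim_def transvection_def
    by (auto intro!: tendsto_add tendsto_mult tendsto_const assms simp del: index_mult_mat_vec)
qed

text \<open>The parameters of the transvections are approximated instead of the matrices. Every
  approximant is then exactly symplectic with an exact rational inverse, and strict positivity of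
  finitely many entries survives for a close enough one.\<close>

lemma rational_symplectic_make_positive:
  assumes LQ: "elements_mat L \<subseteq> \<rat>"
    and v: "v \<in> carrier_vec m" and w: "w \<in> carrier_vec m" and wv: "w \<bullet> v = 1"
  obtains A B where "rational_symplectic A" "rational_symplectic B" "A * B = 1\<^sub>m m" "B * A = 1\<^sub>m m"
    "\<And>i j. i < m \<Longrightarrow> j < m \<Longrightarrow> (A * mat m m (\<lambda>(i, j). v $ i * w $ j) * B) $$ (i, j) > 0"
proof -
  obtain c1 d1 c2 d2 where d: "d1 \<in> carrier_vec m" "d2 \<in> carrier_vec m"
    and pos: "\<And>i. i < m \<Longrightarrow> ((transvection c2 d2 * transvection c1 d1) *\<^sub>v v) $ i > 0"
      "\<And>i. i < m \<Longrightarrow> (transpose_mat (transvection (- c1) d1 * transvection (- c2) d2) *\<^sub>v w) $ i > 0"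
    using transvections_make_positive[OF v w wv] by metis
  obtain a1 where a1: "\<And>k. a1 k \<in> \<rat>" "a1 \<longlonglongrightarrow> c1" by (metis Rats_sequence)
  obtain a2 where a2: "\<And>k. a2 k \<in> \<rat>" "a2 \<longlonglongrightarrow> c2" by (metis Rats_sequence)
  obtain e1 where e1: "\<And>k. e1 k \<in> carrier_vec m" "\<And>k i. i < m \<Longrightarrow> e1 k $ i \<in> \<rat>"
    "\<And>i. i < m \<Longrightarrow> (\<lambda>k. e1 k $ i) \<longlonglongrightarrow> d1 $ i" using Rats_vec_sequence[OF d(1)] by metis
  obtain e2 where e2: "\<And>k. e2 k \<in> carrier_vec m" "\<And>k i. i < m \<Longrightarrow> e2 k $ i \<in> \<rat>"
    "\<And>i. i < m \<Longrightarrow> (\<lambda>k. e2 k $ i) \<longlonglongrightarrow> d2 $ i" using Rats_vec_sequence[OF d(2)] by metis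
  define A B where "A = (\<lambda>k. transvection (a2 k) (e2 k) * transvection (a1 k) (e1 k))"
    and "B = (\<lambda>k. transvection (- a1 k) (e1 k) * transvection (- a2 k) (e2 k))"
  have rat: "rational_symplectic (A k)" "rational_symplectic (B k)" for k
    unfolding A_def B_def using a1 a2 e1 e2 LQ
    by (auto intro!: rational_symplectic_mult rational_symplectic_transvection)
  note t = transvection_carrier and tm = mult_carrier_mat[OF transvection_carrier transvection_carrier]
  have AB: "A k * B k = 1\<^sub>m m" for k
  proof -
    have "A k * B k = transvection (a2 k) (e2 k) *
        ((transvection (a1 k) (e1 k) * transvection (- a1 k) (e1 k)) * transvection (- a2 k) (e2 k))"
      unfolding A_def B_def assoc_mult_mat[OF t t tm] assoc_mult_mat[OF t t t] ..
    then show ?thesis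
      unfolding transvection_inverse[OF e1(1)] left_mult_one_mat[OF t] transvection_inverse[OF e2(1)] .
  qed
  have BA: "B k * A k = 1\<^sub>m m" for k
    by (rule mat_mult_left_right_inverse[OF _ _ AB]) (auto simp: A_def B_def intro: tm)
  let ?E = "mat m m (\<lambda>(i, j). v $ i * w $ j)"
  let ?A = "transvection c2 d2 * transvection c1 d1" and ?B = "transvection (- c1) d1 * transvection (- c2) d2"
  have E: "?E \<in> carrier_mat m m" by simp
  have "mat_lim A ?A" "mat_lim B ?B"
    unfolding A_def B_def
    by (intro mat_lim_mult[of _ m m _ m] t mat_lim_transvection a1 a2 e1 e2 d tendsto_minus; simp)+
  then have "mat_lim (\<lambda>k. A k * ?E * B k) (?A * ?E * ?B)"
    by (intro mat_lim_mult[of _ m m _ m] mat_lim_const mult_carrier_mat[OF _ E] E tm)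
       (auto simp: A_def B_def intro: tm)
  moreover have "?A * ?E * ?B = mat m m (\<lambda>(i, j). (?A *\<^sub>v v) $ i * (transpose_mat ?B *\<^sub>v w) $ j)"
    by (rule rank_one_sandwich[OF tm tm v w])
  ultimately have "mat_lim (\<lambda>k. A k * ?E * B k)
      (mat m m (\<lambda>(i, j). (?A *\<^sub>v v) $ i * (transpose_mat ?B *\<^sub>v w) $ j))" by simp
  from mat_lim_eventually_pos[OF this] pos
  have "\<forall>\<^sub>F k in sequentially. \<forall>i < m. \<forall>j < m. (A k * ?E * B k) $$ (i, j) > 0"
    by (simp del: index_mult_mat_vec index_mult_mat)
  then obtain k where "\<forall>i < m. \<forall>j < m. (A k * ?E * B k) $$ (i, j) > 0"
    using eventually_happens' sequentially_bot by blast
  then show thesis using that[OF rat[of k] AB BA] by blast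
qed

end

section \<open>Integrality of conjugated powers\<close>

text \<open>Pigeonhole: only finitely many residue matrices modulo \<open>q\<close> exist, so two of
  the powers of \<open>N ^ t\<close> agree modulo \<open>q\<close>, and invertibility over the
  integers cancels the smaller one. The factor \<open>t\<close> lets the caller force divisibility
  of the exponent.\<close>

lemma unimodular_pow_cong_one:
  fixes N W :: "int mat"
  assumes N: "N \<in> carrier_mat n n" and W: "W \<in> carrier_mat n n" and NW: "N * W = 1\<^sub>m n" and q: "q > 0"
  obtains p where "p > 0" "\<And>i j. i < n \<Longrightarrow> j < n \<Longrightarrow> q dvd (N ^\<^sub>m (t * p) - 1\<^sub>m n) $$ (i, j)"
proof -
  have Nk: "N ^\<^sub>m k \<in> carrier_mat n n" for k using N by simp
  \<comment> \<open>The residue matrix is flattened to a list of length \<open>n * n\<close> over a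
    finite alphabet, which makes finiteness of the range immediate.\<close>
  define res where "res k = map (\<lambda>(i, j). (N ^\<^sub>m (t * k)) $$ (i, j) mod q) (List.product [0..<n] [0..<n])" for k
  have "res k \<in> {xs. set xs \<subseteq> {0..<q} \<and> length xs = n * n}" for k
    using q by (auto simp: res_def)
  then have "finite (range res)"
    by (intro finite_subset[OF _ finite_lists_length_eq[of "{0..<q}" "n * n"]]) auto
  then have "\<not> inj res" using finite_imageD infinite_UNIV_nat by blast
  then obtain a b where ab: "res a = res b" "a \<noteq> b" unfolding inj_def by blast
  define k l where "k = min a b" and "l = max a b"
  have kl: "res k = res l" "k < l" using ab unfolding k_def l_def by (auto simp: min_def max_def)
  have base: "q dvd (N ^\<^sub>m (t * l) - N ^\<^sub>m (t * k)) $$ (i, j)" if "i < n" "j < n" for i j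
  proof -
    have "(i, j) \<in> set (List.product [0..<n] [0..<n])" using that by simp
    then have "(N ^\<^sub>m (t * l)) $$ (i, j) mod q = (N ^\<^sub>m (t * k)) $$ (i, j) mod q"
      using kl(1)[symmetric] unfolding res_def by (auto simp: map_eq_conv)
    then show ?thesis using carrier_matD[OF N] that by (simp add: mod_eq_dvd_iff)
  qed
  have entry: "(D * W) $$ (i, j) = (\<Sum>l = 0..<n. D $$ (i, l) * W $$ (l, j))"
    if "D \<in> carrier_mat n n" "i < n" "j < n" for D i j
    using that W by (simp add: scalar_prod_def)
  \<comment> \<open>Right multiplication by the integral inverse \<open>W\<close> cancels the common factor \<open>N ^\<^sub>m k\<close> modulo \<open>q\<close>.\<close>
  have descend: "q dvd (N ^\<^sub>m p - 1\<^sub>m n) $$ (i, j)"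
    if "\<And>i j. i < n \<Longrightarrow> j < n \<Longrightarrow> q dvd (N ^\<^sub>m (k + p) - N ^\<^sub>m k) $$ (i, j)" "i < n" "j < n" for k p i j
    using that
  proof (induction k arbitrary: i j)
    case 0
    then show ?case using N by simp
  next
    case (Suc k)
    let ?D = "N ^\<^sub>m (Suc k + p) - N ^\<^sub>m Suc k"
    have cancel: "N ^\<^sub>m Suc s * W = N ^\<^sub>m s" for s
      using assoc_mult_mat[OF Nk[of s] N W] NW right_mult_one_mat[OF Nk[of s]] by simp
    have D: "?D \<in> carrier_mat n n" by (rule minus_carrier_mat[OF Nk])
    have "?D * W = N ^\<^sub>m (Suc k + p) * W - N ^\<^sub>m Suc k * W"
      by (rule minus_mult_distrib_mat[OF Nk Nk W])
    also have "\<dots> = N ^\<^sub>m (k + p) - N ^\<^sub>m k" unfolding add_Suc cancel ..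
    finally have eq: "N ^\<^sub>m (k + p) - N ^\<^sub>m k = ?D * W" ..
    have "q dvd (N ^\<^sub>m (k + p) - N ^\<^sub>m k) $$ (i, j)" if ij: "i < n" "j < n" for i j
    proof -
      have "(?D * W) $$ (i, j) = (\<Sum>l = 0..<n. ?D $$ (i, l) * W $$ (l, j))"
        by (rule entry[OF D ij])
      also have "q dvd \<dots>"
        using Suc.prems(1) ij by (intro dvd_sum dvd_mult2) auto
      finally show ?thesis unfolding eq .
    qed
    then show ?case by (rule Suc.IH[OF _ Suc.prems(2,3)])
  qed
  \<comment> \<open>Here \<open>descend\<close> cancels \<open>t * k\<close> factors, using
    \<open>t * k + t * (l - k) = t * l\<close>.\<close>
  have "q dvd (N ^\<^sub>m (t * (l - k)) - 1\<^sub>m n) $$ (i, j)" if "i < n" "j < n" for i j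
    by (rule descend[of "t * k", OF _ that]) (use base kl(2) in \<open>simp add: add_mult_distrib2[symmetric]\<close>)
  then show thesis using that[of "l - k"] kl(2) by simp
qed

lemma finite_Rats_common_denominator:
  fixes S :: "real set"
  assumes "finite S" "S \<subseteq> \<rat>"
  obtains q :: nat where "q > 0" "\<And>x. x \<in> S \<Longrightarrow> real q * x \<in> \<int>"
proof -
  have "\<exists>q > 0. \<forall>x \<in> S. real q * x \<in> \<int>"
    using assms
  proof (induction S rule: finite_induct)
    case (insert x S)
    then obtain q where q: "q > 0" "\<forall>x \<in> S. real q * x \<in> \<int>" by auto
    from insert.prems have "x \<in> \<rat>" by simp
    then obtain a b where ab: "b > 0" "x = real_of_int a / real_of_int b"
      by (rule Rats_cases') 
    have "real (nat b) * x \<in> \<int>" using ab by simp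
    then have "real q * (real (nat b) * x) \<in> \<int>" by (rule Ints_mult[OF Ints_of_nat])
    moreover have "real (nat b) * (real q * y) \<in> \<int>" if "y \<in> S" for y
      by (rule Ints_mult[OF Ints_of_nat]) (use q that in blast)
    moreover have "real (q * nat b) * y = real q * (real (nat b) * y)"
      "real (q * nat b) * y = real (nat b) * (real q * y)" for y
      unfolding of_nat_mult by (simp_all only: ac_simps)
    ultimately have "\<forall>y \<in> insert x S. real (q * nat b) * y \<in> \<int>"
      by (metis insert_iff)
    then show ?case using q(1) ab(1) by (intro exI[of _ "q * nat b"]) auto
  qed (intro exI[of _ 1]; simp)
  then show thesis using that by blast
qed

lemma finite_elements_mat: "finite (elements_mat A)"
  unfolding elements_mat_def by simp

text \<open>Determinants in \<open>M^T L M = L\<close> give (det M)^2 = 1, as det L is nonzero. So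
  det N is its own inverse, and det N times the adjugate is an integral inverse.\<close>

lemma Sp_int_unimodular:
  assumes form: "symplectic_form m L" and M: "M \<in> Sp_int m L"
  obtains N W :: "int mat" where "N \<in> carrier_mat m m" "W \<in> carrier_mat m m" "N * W = 1\<^sub>m m"
    "M = map_mat real_of_int N"
proof -
  interpret symplectic m L by unfold_locales (rule form)
  have Mc: "M \<in> carrier_mat m m" and Mi: "elements_mat M \<subseteq> \<int>" and Mform: "transpose_mat M * L * M = L"
    using M unfolding Sp_int_def by auto
  define N where "N = map_mat floor M"
  have N: "N \<in> carrier_mat m m" using Mc unfolding N_def by simp
  have MN: "M = map_mat real_of_int N"
  proof (rule eq_matI)
    fix i j assume "i < dim_row (map_mat real_of_int N)" "j < dim_col (map_mat real_of_int N)"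
    then have ij: "i < m" "j < m" using N by auto
    have "M $$ (i, j) \<in> \<int>" using Mi elements_matI[OF Mc ij refl] by blast
    then show "M $$ (i, j) = map_mat real_of_int N $$ (i, j)"
      using ij Mc unfolding N_def by (auto elim: Ints_cases)
  qed (use Mc N in auto)
  have "det L = det (transpose_mat M * L * M)" by (simp only: Mform)
  also have "\<dots> = det M * det L * det M"
    using Mc L by (subst det_mult[of _ m], simp_all) (subst det_mult[of _ m], simp_all add: det_transpose)
  finally have "det M * det M = 1" using det_L by simp
  moreover have "det M = real_of_int (det N)" unfolding MN by (rule of_int_hom.hom_det)
  ultimately have "real_of_int (det N * det N) = 1" by simp
  then have d: "det N * det N = 1" by linarith
  define W where "W = det N \<cdot>\<^sub>m adj_mat N"
  have W: "W \<in> carrier_mat m m" using adj_mat(1)[OF N] unfolding W_def by simp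
  have "N * W = det N \<cdot>\<^sub>m (det N \<cdot>\<^sub>m 1\<^sub>m m)"
    unfolding W_def mult_smult_distrib[OF N adj_mat(1)[OF N]] adj_mat(2)[OF N] ..
  also have "\<dots> = 1\<^sub>m m" using d by (intro eq_matI) (auto simp: mult.assoc[symmetric])
  finally show thesis using that N W MN by blast
qed

section \<open>Rescaling the form to a rational one\<close>

lemma symplectic_form_smult:
  assumes "symplectic_form m L" "c \<noteq> 0"
  shows "symplectic_form m (c \<cdot>\<^sub>m L)"
proof -
  have L: "L \<in> carrier_mat m m" using assms unfolding symplectic_form_def by auto
  have eq: "x \<bullet> ((c \<cdot>\<^sub>m L) *\<^sub>v y) = c * (x \<bullet> (L *\<^sub>v y))" 
    if "x \<in> carrier_vec m" "y \<in> carrier_vec m" for x y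
  proof -
    have "(c \<cdot>\<^sub>m L) *\<^sub>v y = c \<cdot>\<^sub>v (L *\<^sub>v y)"
      using L that by (intro eq_vecI) auto
    then show ?thesis using that L by (simp add: scalar_prod_smult_distrib[of _ m])
  qed
  have skew: "\<forall>x \<in> carrier_vec m. \<forall>y \<in> carrier_vec m. x \<bullet> ((c \<cdot>\<^sub>m L) *\<^sub>v y) = - (y \<bullet> ((c \<cdot>\<^sub>m L) *\<^sub>v x))"
  proof (intro ballI)
    fix x y :: "real vec" assume xy: "x \<in> carrier_vec m" "y \<in> carrier_vec m"
    have "x \<bullet> (L *\<^sub>v y) = - (y \<bullet> (L *\<^sub>v x))"
      using assms(1) xy unfolding symplectic_form_def by blast
    then show "x \<bullet> ((c \<cdot>\<^sub>m L) *\<^sub>v y) = - (y \<bullet> ((c \<cdot>\<^sub>m L) *\<^sub>v x))"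
      unfolding eq[OF xy] eq[OF xy(2,1)] by (simp only: mult_minus_right)
  qed
  have "\<forall>x \<in> carrier_vec m. (\<forall>y \<in> carrier_vec m. x \<bullet> ((c \<cdot>\<^sub>m L) *\<^sub>v y) = 0) \<longrightarrow> x = 0\<^sub>v m"
  proof (intro ballI impI)
    fix x :: "real vec" assume x: "x \<in> carrier_vec m" "\<forall>y \<in> carrier_vec m. x \<bullet> ((c \<cdot>\<^sub>m L) *\<^sub>v y) = 0"
    then have "\<forall>y \<in> carrier_vec m. x \<bullet> (L *\<^sub>v y) = 0" using eq assms(2) by simp
    then show "x = 0\<^sub>v m" using assms(1) x(1) unfolding symplectic_form_def by blast
  qed
  with smult_carrier_mat[OF L, of c] skew show ?thesis
    unfolding symplectic_form_def by (intro conjI)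
qed

lemma preserves_smult_iff:
  fixes A L :: "real mat"
  assumes A: "A \<in> carrier_mat m m" and L: "L \<in> carrier_mat m m" and c: "c \<noteq> 0"
  shows "transpose_mat A * (c \<cdot>\<^sub>m L) * A = c \<cdot>\<^sub>m L \<longleftrightarrow> transpose_mat A * L * A = L"
proof -
  have At: "transpose_mat A \<in> carrier_mat m m" using A by simp
  have "transpose_mat A * (c \<cdot>\<^sub>m L) * A = c \<cdot>\<^sub>m (transpose_mat A * L * A)"
    unfolding mult_smult_distrib[OF At L] mult_smult_assoc_mat[OF mult_carrier_mat[OF At L] A] ..
  moreover have "X = Y" if "c \<cdot>\<^sub>m X = c \<cdot>\<^sub>m Y" for X Y :: "real mat"
  proof -
    have "Z = (1 / c) \<cdot>\<^sub>m (c \<cdot>\<^sub>m Z)" for Z :: "real mat" using c by (intro eq_matI) auto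
    then show "X = Y" using that by metis
  qed
  ultimately show ?thesis by metis
qed

text \<open>The transvections are built for the rational form \<open>c \<cdot>\<^sub>m L\<close>,
  where rational parameters yield rational matrices. A nonzero scalar does not change which matrices
  preserve the form, so the result carries back to \<open>L\<close>.\<close>

lemma rational_preserving_make_positive:
  assumes form: "symplectic_form m L" and c: "c \<noteq> 0" "elements_mat (c \<cdot>\<^sub>m L) \<subseteq> \<rat>"
    and vw: "v \<in> carrier_vec m" "w \<in> carrier_vec m" "w \<bullet> v = 1"
  obtains A B where "A \<in> carrier_mat m m" "B \<in> carrier_mat m m"
    "elements_mat A \<subseteq> \<rat>" "elements_mat B \<subseteq> \<rat>"
    "transpose_mat A * L * A = L" "transpose_mat B * L * B = L"
    "A * B = 1\<^sub>m m" "B * A = 1\<^sub>m m"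
    "\<And>i j. i < m \<Longrightarrow> j < m \<Longrightarrow> (A * mat m m (\<lambda>(i, j). v $ i * w $ j) * B) $$ (i, j) > 0"
proof -
  have L: "L \<in> carrier_mat m m" using form unfolding symplectic_form_def by blast
  have sym: "symplectic m (c \<cdot>\<^sub>m L)"
    by (rule symplectic.intro[OF symplectic_form_smult[OF form c(1)]])
  obtain A B where rat: "symplectic.rational_symplectic m (c \<cdot>\<^sub>m L) A"
      "symplectic.rational_symplectic m (c \<cdot>\<^sub>m L) B"
    and AB: "A * B = 1\<^sub>m m" "B * A = 1\<^sub>m m"
      "\<And>i j. i < m \<Longrightarrow> j < m \<Longrightarrow> (A * mat m m (\<lambda>(i, j). v $ i * w $ j) * B) $$ (i, j) > 0"
    by (rule symplectic.rational_symplectic_make_positive[OF sym c(2) vw]) blast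
  note rs = rat[unfolded symplectic.rational_symplectic_def[OF sym]]
  have "A \<in> carrier_mat m m" "B \<in> carrier_mat m m" using rs by blast+
  moreover from this have "transpose_mat A * L * A = L" "transpose_mat B * L * B = L"
    using rs preserves_smult_iff[OF _ L c(1)] by blast+
  ultimately show thesis using that[OF _ _ _ _ _ _ AB] rs by blast
qed

section \<open>Conjugated powers: invariance of the form and integrality\<close>

lemma Sp_int_pow:
  assumes form: "symplectic_form m L" and M: "M \<in> Sp_int m L"
  shows "transpose_mat (M ^\<^sub>m k) * L * (M ^\<^sub>m k) = L"
proof (induction k)
  case 0
  have "M \<in> carrier_mat m m" "L \<in> carrier_mat m m"
    using M form unfolding Sp_int_def symplectic_form_def by blast+
  then show ?case by simp
next
  case (Suc k)
  interpret symplectic m L by unfold_locales (rule form)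
  have M': "M \<in> carrier_mat m m" "transpose_mat M * L * M = L"
    using M unfolding Sp_int_def by auto
  show ?case unfolding pow_mat.simps
    by (rule preserves_mult[OF pow_carrier_mat[OF M'(1)] M'(1) Suc M'(2)])
qed

text \<open>Writing N = 1 + q^2 X with X integral gives A N B = 1 + (q A) X (q B). The square in the
  modulus supplies one denominator for \<open>A\<close> and one for \<open>B\<close>.\<close>

lemma conj_integral:
  fixes A B :: "real mat" and N :: "int mat"
  assumes A: "A \<in> carrier_mat m m" and B: "B \<in> carrier_mat m m" and N: "N \<in> carrier_mat m m"
    and AB: "A * B = 1\<^sub>m m"
    and q: "\<And>x. x \<in> elements_mat A \<union> elements_mat B \<Longrightarrow> real q * x \<in> \<int>"
    and dvd: "\<And>i j. i < m \<Longrightarrow> j < m \<Longrightarrow> int q * int q dvd (N - 1\<^sub>m m) $$ (i, j)"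
  shows "elements_mat (A * map_mat real_of_int N * B) \<subseteq> \<int>"
proof -
  \<comment> \<open>The integer division is exact by \<open>dvd\<close>.\<close>
  define X where "X = mat m m (\<lambda>ij. real_of_int ((N - 1\<^sub>m m) $$ ij div (int q * int q)))"
  define s where "s = real q"
  have X: "X \<in> carrier_mat m m" unfolding X_def by simp
  have "map_mat real_of_int N = 1\<^sub>m m + s \<cdot>\<^sub>m (s \<cdot>\<^sub>m X)"
  proof (rule eq_matI)
    fix i j assume "i < dim_row (1\<^sub>m m + s \<cdot>\<^sub>m (s \<cdot>\<^sub>m X))" "j < dim_col (1\<^sub>m m + s \<cdot>\<^sub>m (s \<cdot>\<^sub>m X))"
    then have ij: "i < m" "j < m" using X by auto
    define x where "x = (N - 1\<^sub>m m) $$ (i, j)"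
    have "int q * int q * (x div (int q * int q)) = x"
      using dvd[OF ij] unfolding x_def by (rule dvd_mult_div_cancel)
    then have "real_of_int (int q * int q * (x div (int q * int q))) = real_of_int x" by (rule arg_cong)
    then have "s * (s * X $$ (i, j)) = real_of_int x"
      using ij unfolding X_def s_def x_def[symmetric] by (simp add: x_def[symmetric] mult.assoc)
    moreover have "real_of_int x = real_of_int (N $$ (i, j)) - 1\<^sub>m m $$ (i, j)"
      using ij N unfolding x_def by simp
    ultimately show "map_mat real_of_int N $$ (i, j) = (1\<^sub>m m + s \<cdot>\<^sub>m (s \<cdot>\<^sub>m X)) $$ (i, j)"
      using ij N X by simp
  qed (use N X in auto)
  moreover have sX: "s \<cdot>\<^sub>m X \<in> carrier_mat m m" "s \<cdot>\<^sub>m (s \<cdot>\<^sub>m X) \<in> carrier_mat m m"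
    "s \<cdot>\<^sub>m A \<in> carrier_mat m m" "s \<cdot>\<^sub>m B \<in> carrier_mat m m" using X A B by auto
  ultimately have "A * map_mat real_of_int N * B = (A + A * (s \<cdot>\<^sub>m (s \<cdot>\<^sub>m X))) * B"
    using mult_add_distrib_mat[OF A one_carrier_mat sX(2)] right_mult_one_mat[OF A] by simp
  also have "\<dots> = 1\<^sub>m m + A * (s \<cdot>\<^sub>m (s \<cdot>\<^sub>m X)) * B"
    using add_mult_distrib_mat[OF A mult_carrier_mat[OF A sX(2)] B] AB by simp
  also have "A * (s \<cdot>\<^sub>m (s \<cdot>\<^sub>m X)) * B = s \<cdot>\<^sub>m A * X * (s \<cdot>\<^sub>m B)"
    unfolding mult_smult_distrib[OF A sX(1)] mult_smult_distrib[OF A X]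
      mult_smult_assoc_mat[OF A X]
      mult_smult_distrib[OF smult_carrier_mat[OF mult_carrier_mat[OF A X]] B]
      mult_smult_assoc_mat[OF smult_carrier_mat[OF mult_carrier_mat[OF A X]] B] ..
  finally have eq: "A * map_mat real_of_int N * B = 1\<^sub>m m + s \<cdot>\<^sub>m A * X * (s \<cdot>\<^sub>m B)" .
  have ints: "elements_mat (s \<cdot>\<^sub>m A) \<subseteq> \<int>" "elements_mat (s \<cdot>\<^sub>m B) \<subseteq> \<int>" "elements_mat X \<subseteq> \<int>"
  proof -
    have "s * A $$ (i, j) \<in> \<int>" "s * B $$ (i, j) \<in> \<int>" if "i < m" "j < m" for i j
      using q elements_matI[OF A that refl] elements_matI[OF B that refl] unfolding s_def by blast+
    then show "elements_mat (s \<cdot>\<^sub>m A) \<subseteq> \<int>" "elements_mat (s \<cdot>\<^sub>m B) \<subseteq> \<int>"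
      using A B by (auto dest!: elements_matD)
    show "elements_mat X \<subseteq> \<int>" unfolding X_def by (auto dest!: elements_matD)
  qed
  have prod: "elements_mat (s \<cdot>\<^sub>m A * X * (s \<cdot>\<^sub>m B)) \<subseteq> \<int>"
    by (intro elements_mat_mult_subset[of _ m m _ _ m] mult_carrier_mat[of _ m m] sX X ints Ints_0 Ints_add Ints_mult)
  have P: "s \<cdot>\<^sub>m A * X * (s \<cdot>\<^sub>m B) \<in> carrier_mat m m"
    by (intro mult_carrier_mat[of _ m m] sX X)
  show ?thesis
  proof
    fix x assume "x \<in> elements_mat (A * map_mat real_of_int N * B)"
    then obtain i j where ij: "i < m" "j < m" and x: "x = 1\<^sub>m m $$ (i, j) + (s \<cdot>\<^sub>m A * X * (s \<cdot>\<^sub>m B)) $$ (i, j)"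
      unfolding eq using P by (auto simp del: index_mult_mat dest!: elements_matD)
    have "(s \<cdot>\<^sub>m A * X * (s \<cdot>\<^sub>m B)) $$ (i, j) \<in> \<int>" using prod elements_matI[OF P ij refl] by blast
    then show "x \<in> \<int>" unfolding x using ij by (intro Ints_add) auto
  qed
qed

section \<open>Choosing the exponent and the conjugating matrix\<close>

theorem theorem4:
  fixes g :: nat and L M :: "real mat" and r :: real
  assumes "symplectic_form (2 * g) L"
    and "\<exists>c. c \<noteq> 0 \<and> elements_mat (c \<cdot>\<^sub>m L) \<subseteq> \<rat>"
    and "M \<in> Sp_int (2 * g) L"
    and "simple_dominant_eigenvalue M r"
    and "\<bar>r\<bar> > 1"
  shows "\<exists>n \<ge> 1. \<exists>B \<in> carrier_mat (2 * g) (2 * g). \<exists>B' \<in> carrier_mat (2 * g) (2 * g).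
           inverts_mat B B' \<and> inverts_mat B' B \<and>
           Perron_Frobenius_mat (B' * (M ^\<^sub>m n) * B) \<and>
           B' * (M ^\<^sub>m n) * B \<in> Sp_int (2 * g) L"
proof -
  define m where "m = 2 * g"
  note form = assms(1)[folded m_def] and M_Sp = assms(3)[folded m_def]
  interpret symplectic m L by unfold_locales (rule form)
  have M: "M \<in> carrier_mat m m" using M_Sp unfolding Sp_int_def by auto
  have Mk: "M ^\<^sub>m k \<in> carrier_mat m m" for k using M by simp
  have r: "r \<noteq> 0" using assms(5) by auto
  obtain c where c: "c \<noteq> 0" "elements_mat (c \<cdot>\<^sub>m L) \<subseteq> \<rat>" using assms(2) by metis
  obtain v w where v: "v \<in> carrier_vec m" and w: "w \<in> carrier_vec m" and wv: "w \<bullet> v = 1"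
    and lim: "mat_lim (\<lambda>k. (1 / r ^ k) \<cdot>\<^sub>m (M ^\<^sub>m k)) (mat m m (\<lambda>(i, j). v $ i * w $ j))"
    by (rule simple_dominant_eigenvalue_power_limit[OF M assms(4) r])
  let ?E = "mat m m (\<lambda>(i, j). v $ i * w $ j)"
  obtain A B where A: "A \<in> carrier_mat m m" and B: "B \<in> carrier_mat m m"
    and ratA: "elements_mat A \<subseteq> \<rat>" and ratB: "elements_mat B \<subseteq> \<rat>"
    and presA: "transpose_mat A * L * A = L" and presB: "transpose_mat B * L * B = L"
    and AB: "A * B = 1\<^sub>m m" and BA: "B * A = 1\<^sub>m m"
    and pos: "\<And>i j. i < m \<Longrightarrow> j < m \<Longrightarrow> (A * ?E * B) $$ (i, j) > 0"
    by (rule rational_preserving_make_positive[OF form c v w wv]) blast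
  have E: "?E \<in> carrier_mat m m" by simp
  have Rk: "(1 / r ^ k) \<cdot>\<^sub>m (M ^\<^sub>m k) \<in> carrier_mat m m" for k using Mk by simp
  have "mat_lim (\<lambda>k. A * ((1 / r ^ k) \<cdot>\<^sub>m (M ^\<^sub>m k)) * B) (A * ?E * B)"
    by (intro mat_lim_mult[of _ m m _ m] mat_lim_const lim mult_carrier_mat[of _ m m] A B E Rk)
  from mat_lim_eventually_pos[OF this] pos A B
  have "\<forall>\<^sub>F k in sequentially. \<forall>i < m. \<forall>j < m. (A * ((1 / r ^ k) \<cdot>\<^sub>m (M ^\<^sub>m k)) * B) $$ (i, j) > 0"
    by (simp del: index_mult_mat(1))
  then obtain K where K: "\<And>k i j. k \<ge> K \<Longrightarrow> i < m \<Longrightarrow> j < m \<Longrightarrow>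
      (A * ((1 / r ^ k) \<cdot>\<^sub>m (M ^\<^sub>m k)) * B) $$ (i, j) > 0"
    unfolding eventually_sequentially by blast
  have "elements_mat A \<union> elements_mat B \<subseteq> \<rat>" using ratA ratB by blast
  then obtain q :: nat where q: "q > 0" "\<And>x. x \<in> elements_mat A \<union> elements_mat B \<Longrightarrow> real q * x \<in> \<int>"
    using finite_Rats_common_denominator[of "elements_mat A \<union> elements_mat B"] finite_elements_mat by blast
  obtain N W :: "int mat" where N: "N \<in> carrier_mat m m" and W: "W \<in> carrier_mat m m"
    and NW: "N * W = 1\<^sub>m m" and MN: "M = map_mat real_of_int N"
    by (rule Sp_int_unimodular[OF form M_Sp])
  \<comment> \<open>The exponent will be a positive multiple of \<open>t\<close>: at least
    \<open>K\<close>, so that the normalised conjugate is positive, and even, so that dividing by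
    its power of \<open>r\<close> preserves signs even for negative \<open>r\<close>.\<close>
  define t where "t = 2 * (K + 1)"
  obtain p where p: "p > 0"
    and dvd: "\<And>i j. i < m \<Longrightarrow> j < m \<Longrightarrow> int q * int q dvd (N ^\<^sub>m (t * p) - 1\<^sub>m m) $$ (i, j)"
    using unimodular_pow_cong_one[OF N W NW, of "int q * int q" t] q(1) by (metis mult_pos_pos of_nat_0_less_iff)
  define n where "n = t * p"
  have n: "n \<ge> 1" "n \<ge> K" "even n"
  proof -
    have "t \<le> n" using p unfolding n_def by simp
    then show "n \<ge> 1" "n \<ge> K" unfolding t_def by auto
    show "even n" unfolding n_def t_def by simp
  qed
  define C where "C = A * M ^\<^sub>m n * B"
  have C: "C \<in> carrier_mat m m" unfolding C_def by (intro mult_carrier_mat[of _ m m] A B Mk)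
  have "M ^\<^sub>m n = map_mat real_of_int (N ^\<^sub>m n)"
    unfolding MN by (rule of_int_hom.mat_hom_pow[OF N, symmetric])
  then have Cint: "elements_mat C \<subseteq> \<int>"
    unfolding C_def
    using conj_integral[OF A B pow_carrier_mat[OF N] AB q(2) dvd] unfolding n_def by simp
  have Cpos: "C $$ (i, j) > 0" if ij: "i < m" "j < m" for i j
  proof -
    have "A * ((1 / r ^ n) \<cdot>\<^sub>m (M ^\<^sub>m n)) * B = (1 / r ^ n) \<cdot>\<^sub>m C"
      unfolding C_def mult_smult_distrib[OF A Mk] mult_smult_assoc_mat[OF mult_carrier_mat[OF A Mk] B] ..
    then have "1 / r ^ n * C $$ (i, j) > 0" using K[OF n(2) ij] C ij by simp
    moreover have "1 / r ^ n > 0" using n(3) r by (simp add: zero_less_power_eq)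
    ultimately show ?thesis by (rule zero_less_mult_pos)
  qed
  then have "\<forall>a \<in> elements_mat C. a > 0" using C by (auto dest!: elements_matD)
  \<comment> \<open>All entries of \<open>C\<close> are already positive, so the exponent 1
    witnesses the Perron-Frobenius property.\<close>
  moreover have "C ^\<^sub>m 1 = C" using C by simp
  ultimately have pf: "Perron_Frobenius_mat C"
    unfolding Perron_Frobenius_mat_def using C by (metis carrier_matD less_imp_le order_refl square_mat.simps)
  have "transpose_mat C * L * C = L"
    unfolding C_def
    by (intro preserves_mult mult_carrier_mat[of _ m m] A B Mk presA presB Sp_int_pow[OF form M_Sp])
  then have "C \<in> Sp_int m L" using C Cint unfolding Sp_int_def by simp
  moreover have "inverts_mat B A" "inverts_mat A B" using A B AB BA unfolding inverts_mat_def by auto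
  ultimately show ?thesis
    \<comment> \<open>\<open>A\<close> takes the place of the inverse \<open>B'\<close> in the
      conclusion.\<close>
    using n(1) A B pf unfolding C_def m_def by blast
qed

end
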